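(* There is an algorithm that, given the binary representations of $n$, $a_1$, $a_2$ of a two-stripe symmetric circulant TSP instance satisfying the standing assumptions below, computes the cost of an optimal (minimum-cost) Hamiltonian tour in $O(\log^2 n)$ time; moreover, in an additional $O(\log^2 n)$ time it can output a constant-size set of parameters describing an optimal tour, and it can output the sequence of $n$ vertices of an optimal tour in $O(n)$ time.
   Context: Two-stripe symmetric circulant TSP: the vertex set is $\mathbb{Z}_n$, and for two distinct integers $a_1,a_2\in\{1,\dots,\lfloor n/2\rfloor\}$ the only finite-cost edges are $\{v,v\pm a_1\bmod n\}$ (cost $0$) and $\{v,v\pm a_2\bmod n\}$ (cost $1$); one seeks a Hamiltonian cycle minimizing the number of edges of length $a_2$. Standing assumptions: $\gcd(n,a_1)>1$ and $\gcd(n,a_1,a_2)=1$. *)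

theory Defs
  imports Complex_Main "HOL-Library.Log_Nat" "HOL-Library.Extended_Nat"
begin

section \<open>The two-stripe symmetric circulant TSP\<close>

text \<open>The residues modulo \<open>n\<close> are represented by the numbers in \<open>{..<n}\<close>.\<close>

definition two_stripe_instance :: "nat \<Rightarrow> nat \<Rightarrow> nat \<Rightarrow> bool" where
  "two_stripe_instance n a1 a2 \<longleftrightarrow>
     a1 \<in> {1..n div 2} \<and> a2 \<in> {1..n div 2} \<and> a1 \<noteq> a2 \<and>
     gcd n a1 > 1 \<and> gcd (gcd n a1) a2 = 1"

definition stripe_edge :: "nat \<Rightarrow> nat \<Rightarrow> nat \<Rightarrow> nat \<Rightarrow> bool" where
  "stripe_edge n a u v \<longleftrightarrow> (u + a) mod n = v \<or> (v + a) mod n = u"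

definition edge_cost :: "nat \<Rightarrow> nat \<Rightarrow> nat \<Rightarrow> nat \<Rightarrow> nat \<Rightarrow> enat" where
  "edge_cost n a1 a2 u v =
     (if stripe_edge n a1 u v then 0 else if stripe_edge n a2 u v then 1 else \<infinity>)"

text \<open>A Hamiltonian cycle of the complete graph is given by the sequence of its vertices.
  Instances have \<open>n \<ge> 4\<close>, so no edge is used twice.\<close>

definition is_tour :: "nat \<Rightarrow> nat list \<Rightarrow> bool" where
  "is_tour n xs \<longleftrightarrow> distinct xs \<and> set xs = {..<n}"

definition tour_cost :: "nat \<Rightarrow> nat \<Rightarrow> nat \<Rightarrow> nat list \<Rightarrow> enat" where
  "tour_cost n a1 a2 xs = (\<Sum>i<n. edge_cost n a1 a2 (xs ! i) (xs ! (Suc i mod n)))"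

definition optimal_tour :: "nat \<Rightarrow> nat \<Rightarrow> nat \<Rightarrow> nat list \<Rightarrow> bool" where
  "optimal_tour n a1 a2 xs \<longleftrightarrow>
     is_tour n xs \<and> (\<forall>ys. is_tour n ys \<longrightarrow> tour_cost n a1 a2 xs \<le> tour_cost n a1 a2 ys)"


section \<open>The model of computation\<close>

text \<open>
  Programs work on registers that hold natural numbers in binary. There is no indirect
  addressing, so a fixed program uses a fixed finite set of registers.
\<close>

datatype operation = Plus | Minus | Times | Divide | Modulo

fun apply_op :: "operation \<Rightarrow> nat \<Rightarrow> nat \<Rightarrow> nat" where
  "apply_op Plus x y = x + y"
| "apply_op Minus x y = x - y"
| "apply_op Times x y = x * y"
| "apply_op Divide x y = x div y"
| "apply_op Modulo x y = x mod y"

text \<open>The binary digits and an end mark (so that \<open>0\<close> has positive length).\<close>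

definition numlen :: "nat \<Rightarrow> nat" where
  "numlen x = Suc (floorlog 2 x)"

text \<open>
  The number of bit operations (of a multitape Turing machine, up to a constant factor) of
  the schoolbook methods. Long division computes about \<open>numlen x - numlen y\<close> digits of the
  quotient, each by one subtraction of numbers of the length of \<open>y\<close>.
\<close>

fun op_bits :: "operation \<Rightarrow> nat \<Rightarrow> nat \<Rightarrow> nat" where
  "op_bits Plus x y = numlen x + numlen y"
| "op_bits Minus x y = numlen x + numlen y"
| "op_bits Times x y = numlen x * numlen y"
| "op_bits Divide x y = numlen x + numlen y * Suc (numlen x - numlen y)"
| "op_bits Modulo x y = numlen x + numlen y * Suc (numlen x - numlen y)"

type_synonym reg = nat
type_synonym state = "reg \<Rightarrow> nat"

datatype test = Less reg reg | Equal reg reg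

fun holds :: "test \<Rightarrow> state \<Rightarrow> bool" where
  "holds (Less i j) s \<longleftrightarrow> s i < s j"
| "holds (Equal i j) s \<longleftrightarrow> s i = s j"

fun test_bits :: "test \<Rightarrow> state \<Rightarrow> nat" where
  "test_bits (Less i j) s = numlen (s i) + numlen (s j)"
| "test_bits (Equal i j) s = numlen (s i) + numlen (s j)"

datatype prog =
    Skip
  | Const reg nat
  | Move reg reg
  | Op reg operation reg reg
  | Emit reg
  | Seq prog prog
  | If test prog prog
  | While test prog

text \<open>
  \<open>exec W p s out t b s'\<close>: from state \<open>s\<close>, program \<open>p\<close> terminates in state \<open>s'\<close>, emits the
  numbers \<open>out\<close>, and writes only numbers of length at most \<open>W\<close>. Its time is \<open>t\<close> at unit cost
  per instruction (word RAM with words of length \<open>W\<close>) and \<open>b\<close> in bit operations.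
\<close>

inductive exec ::
  "nat \<Rightarrow> prog \<Rightarrow> state \<Rightarrow> nat list \<Rightarrow> nat \<Rightarrow> nat \<Rightarrow> state \<Rightarrow> bool" for W :: nat where
  exec_Skip: "exec W Skip s [] 1 1 s"
| exec_Const: "numlen c \<le> W \<Longrightarrow> exec W (Const i c) s [] 1 (numlen c) (s(i := c))"
| exec_Move: "numlen (s j) \<le> W \<Longrightarrow> exec W (Move i j) s [] 1 (numlen (s j)) (s(i := s j))"
| exec_Op: "numlen (apply_op f (s j) (s k)) \<le> W \<Longrightarrow>
    exec W (Op i f j k) s [] 1 (op_bits f (s j) (s k)) (s(i := apply_op f (s j) (s k)))"
| exec_Emit: "exec W (Emit i) s [s i] 1 (numlen (s i)) s"
| exec_Seq: "exec W p s out1 t1 b1 s1 \<Longrightarrow> exec W q s1 out2 t2 b2 s2 \<Longrightarrow>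
    exec W (Seq p q) s (out1 @ out2) (t1 + t2) (b1 + b2) s2"
| exec_If_true: "holds c s \<Longrightarrow> exec W p s out t b s1 \<Longrightarrow>
    exec W (If c p q) s out (Suc t) (test_bits c s + b) s1"
| exec_If_false: "\<not> holds c s \<Longrightarrow> exec W q s out t b s1 \<Longrightarrow>
    exec W (If c p q) s out (Suc t) (test_bits c s + b) s1"
| exec_While_false: "\<not> holds c s \<Longrightarrow> exec W (While c p) s [] 1 (test_bits c s) s"
| exec_While_true: "holds c s \<Longrightarrow> exec W p s out1 t1 b1 s1 \<Longrightarrow>
    exec W (While c p) s1 out2 t2 b2 s2 \<Longrightarrow>
    exec W (While c p) s (out1 @ out2) (Suc (t1 + t2)) (test_bits c s + b1 + b2) s2"

definition input_state :: "nat list \<Rightarrow> state" where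
  "input_state xs = (\<lambda>i. if i < length xs then xs ! i else 0)"

fun loop_free :: "prog \<Rightarrow> bool" where
  "loop_free (Seq p q) \<longleftrightarrow> loop_free p \<and> loop_free q"
| "loop_free (If c p q) \<longleftrightarrow> loop_free p \<and> loop_free q"
| "loop_free (While c p) \<longleftrightarrow> False"
| "loop_free _ \<longleftrightarrow> True"

text \<open>
  The parameters \<open>ps\<close> describe the sequence \<open>xs\<close> by means of \<open>d\<close>: from the instance, the
  parameters and a position, \<open>d\<close> computes the vertex at that position. If \<open>d\<close> is loop-free, it
  is an explicit formula with case distinctions for a parametrized class of sequences; this
  excludes that \<open>d\<close> solves the instance itself (with, say, no parameters at all).
\<close>

definition describes ::
  "nat \<Rightarrow> prog \<Rightarrow> nat \<Rightarrow> nat \<Rightarrow> nat \<Rightarrow> nat list \<Rightarrow> nat list \<Rightarrow> bool" where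
  "describes W d n a1 a2 ps xs \<longleftrightarrow>
     (\<forall>i<length xs. \<exists>t b s. exec W d (input_state ([n, a1, a2, i] @ ps)) [xs ! i] t b s)"

end

theory Submission
  imports Defs "HOL-Number_Theory.Cong"
begin

text \<open>
  Let \<open>g = gcd n a1\<close> and \<open>r = n div g\<close>. The residues form a twisted torus of \<open>g\<close> columns (the
  cycles of the edges of length \<open>a1\<close>) and \<open>r\<close> rows; the edges of length \<open>a2\<close> join consecutive
  columns, and those from the last to the first column shift the rows by \<open>t\<close>, where
  \<open>g * a2 = t * a1\<close> modulo \<open>n\<close>.

  Lower bound: a tour crosses the boundary of every vertex set an even number of times. For sets of
  columns this shows that the numbers of crossings of the gaps between columns have the same
  parity. If they are even, at most one is zero, and the cost is at least \<open>2 * (g - 1)\<close>. If they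
  are odd and the cost is smaller, some gap is crossed once. With the seam of the torus at this
  gap, the boundaries of sets of rows show that the parity of the number of edges of length \<open>a1\<close>
  between rows \<open>x\<close> and \<open>x + 1\<close> that the tour leaves out changes only at the two ends of the seam
  edge. It is hence odd for exactly \<open>t\<close> or exactly \<open>r - t\<close> of the \<open>x\<close>. Since a tour leaves out as
  many edges of length \<open>a1\<close> as it has edges of length \<open>a2\<close>, the cost is at least \<open>t\<close> or
  \<open>r - t\<close>, and of the same parity. Explicit tours attain these bounds.

  The extended Euclidean algorithm finds \<open>t\<close>, and its bit operations sum up to \<open>O(log\<^sup>2 n)\<close> because
  the lengths of the quotients sum up to \<open>O(log n)\<close>.
\<close>

section \<open>Programs without loops\<close>

text \<open>The analysis treats the two loops separately from everything else. A fixed number of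
  instructions on registers of length O(log n) costs O(log n)^2 bit operations, so every loop-free
  piece is settled by one general lemma. For the Euclidean loop this argument would lose a factor
  log n, and its cost is amortized instead. For the output loop only unit-cost time is claimed, but
  the width must not grow from round to round. Natural numbers have no signs, which explains several
  encodings: a sign bit for the Bezout coefficients, the step \<open>n - a1\<close> for walking the
  rows backwards (it turns the shift \<open>t\<close> into \<open>r - t\<close>), and the offset
  \<open>4 * n\<close> in the row numbers. Registers: 0 to 2 hold the instance, 3 a position, 4 to 9
  the parameters \<open>g\<close>, \<open>r\<close>, \<open>z\<close>, \<open>m\<close>,
  \<open>u\<close>, \<open>b\<close>; 10 to 17 serve the Euclidean algorithm, 18 is the constant 0,
  20 to 26 are used for planning, 39 holds a vertex to emit, and the evaluation stack starts at 40.
  The state after planning is exactly the input of the decoder at position 0.\<close>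

lemma numlen_mono: "x \<le> y \<Longrightarrow> numlen x \<le> numlen y"
  by (simp add: numlen_def floorlog_mono)

lemma numlen_le_Suc_iff: "numlen x \<le> Suc w \<longleftrightarrow> x < 2 ^ w"
  by (simp add: numlen_def floorlog_le_iff)

lemma numlen_ge_1: "1 \<le> numlen x"
  by (simp add: numlen_def)

lemma numlen_0 [simp]: "numlen 0 = 1"
  by (simp add: numlen_def floorlog_def)

lemma obtain_numlen:
  obtains w where "numlen x = Suc w" "x < 2 ^ w"
  by (metis le_refl numlen_def numlen_le_Suc_iff)

text \<open>Products are the extreme case; the carry of a sum is absorbed by the end mark counted in
  \<open>numlen\<close>.\<close>

lemma numlen_apply_op: "numlen (apply_op f x y) \<le> numlen x + numlen y"
proof -
  obtain a where a: "numlen x = Suc a" "x < 2 ^ a" by (rule obtain_numlen)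
  obtain b where b: "numlen y = Suc b" "y < 2 ^ b" by (rule obtain_numlen)
  have ba: "(2::nat) ^ a \<le> 2 ^ (a + b)" and bb: "(2::nat) ^ b \<le> 2 ^ (a + b)"
    by (simp_all add: power_increasing)
  have "apply_op f x y < 2 ^ (Suc (a + b))"
  proof (cases f)
    case Plus
    have "x + y < 2 * 2 ^ (a + b)" using a b ba bb by linarith
    then show ?thesis using Plus by simp
  next
    case Minus
    have "x - y < 2 * 2 ^ (a + b)" using a ba by linarith
    then show ?thesis using Minus by simp
  next
    case Times
    have "x * y < 2 ^ a * 2 ^ b"
      using a b by (intro mult_strict_mono) auto
    then show ?thesis using Times by (simp add: power_add)
  next
    case Divide
    have "x div y \<le> x" by simp
    then have "x div y < 2 ^ (a + b)" using a ba by linarith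
    then show ?thesis using Divide by simp
  next
    case Modulo
    have "x mod y \<le> x" by simp
    then have "x mod y < 2 ^ (a + b)" using a ba by linarith
    then show ?thesis using Modulo by simp
  qed
  then have "numlen (apply_op f x y) \<le> Suc (Suc (a + b))"
    unfolding numlen_le_Suc_iff .
  then show ?thesis using a b by simp
qed

lemma exec_mono_width: "exec W p s out t b s' \<Longrightarrow> W \<le> W' \<Longrightarrow> exec W' p s out t b s'"
  by (induction rule: exec.induct) (auto intro: exec.intros simp del: One_nat_def)

lemma op_bits_le:
  assumes "numlen x \<le> W" "numlen y \<le> W"
  shows "op_bits f x y \<le> 3 * W\<^sup>2"
proof -
  have W: "1 \<le> W" using assms(1) numlen_ge_1[of x] by linarith
  then have WW: "W \<le> W * W" by simp
  have le: "numlen y * Suc (numlen x - numlen y) \<le> W * Suc W"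
    using assms by (intro mult_le_mono) auto
  have "numlen x * numlen y \<le> W * W"
    using assms by (intro mult_le_mono) auto
  with WW le assms show ?thesis
    unfolding power2_eq_square by (cases f; simp only: op_bits.simps mult_Suc_right; linarith)
qed

text \<open>No instruction on numbers of length at most \<open>W\<close> costs more than
  quadratically many bit operations, so a unit-cost bound yields a bit bound. This is sharp enough
  for constantly many instructions only; the Euclidean loop, with O(log n) rounds, is counted
  directly.\<close>

lemma exec_bits_le:
  assumes exec: "exec W p s out t b s'" and s: "\<And>i. numlen (s i) \<le> W"
  shows "(\<forall>i. numlen (s' i) \<le> W) \<and> b \<le> t * (3 * W\<^sup>2)"
proof -
  define Q where "Q = 3 * W\<^sup>2"
  have "1 \<le> W" using s[of 0] numlen_ge_1[of "s 0"] by linarith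
  then have "W \<le> W\<^sup>2" by (simp add: power2_eq_square)
  then have Q: "2 * W \<le> Q" "1 \<le> Q" "W \<le> Q" using \<open>1 \<le> W\<close> by (simp_all add: Q_def)
  have test: "test_bits c s \<le> Q" if "\<And>i. numlen (s i) \<le> W" for c s
  proof (cases c)
    case (Less i j)
    then show ?thesis using that[of i] that[of j] Q by simp
  next
    case (Equal i j)
    then show ?thesis using that[of i] that[of j] Q by simp
  qed
  have "(\<forall>i. numlen (s' i) \<le> W) \<and> b \<le> t * Q"
    using exec s
  proof (induction rule: exec.induct)
    case (exec_Op f s j k i)
    then show ?case using op_bits_le[of "s j" W "s k" f] by (simp add: Q_def)
  next
    case (exec_Seq p s out1 t1 b1 s1 q out2 t2 b2 s2)
    then show ?case by (simp add: add_mult_distrib add_mono)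
  next
    case (exec_If_true c s p out t b s1 q)
    then show ?case using test[of s c] by (simp add: add_mono)
  next
    case (exec_If_false c s q out t b s1 p)
    then show ?case using test[of s c] by (simp add: add_mono)
  next
    case (exec_While_false c s p)
    then show ?case using test[of s c] by simp
  next
    case (exec_While_true c s p out1 t1 b1 s1 out2 t2 b2 s2)
    then show ?case using test[of s c] by (simp add: add_mult_distrib add_mono)
  next
    case (exec_Move s j i)
    have "numlen (s j) \<le> Q" using Q exec_Move.prems[of j] by linarith
    then show ?case using exec_Move by simp
  next
    case (exec_Emit i s)
    have "numlen (s i) \<le> Q" using Q exec_Emit[of i] by linarith
    then show ?case using exec_Emit by simp
  qed (use Q in auto)
  then show ?thesis by (simp add: Q_def)
qed

text \<open>On loop-free programs execution is a total function of the state, so derivations of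
  \<open>exec\<close> can be replaced by simplification with \<open>result\<close>,
  \<open>emitted\<close> and \<open>bits\<close>.\<close>

primrec result :: "prog \<Rightarrow> state \<Rightarrow> state" where
  "result Skip s = s"
| "result (Const i c) s = s(i := c)"
| "result (Move i j) s = s(i := s j)"
| "result (Op i f j k) s = s(i := apply_op f (s j) (s k))"
| "result (Emit i) s = s"
| "result (Seq p q) s = result q (result p s)"
| "result (If c p q) s = (if holds c s then result p s else result q s)"
| "result (While c p) s = s"

primrec emitted :: "prog \<Rightarrow> state \<Rightarrow> nat list" where
  "emitted Skip s = []"
| "emitted (Const i c) s = []"
| "emitted (Move i j) s = []"
| "emitted (Op i f j k) s = []"
| "emitted (Emit i) s = [s i]"
| "emitted (Seq p q) s = emitted p s @ emitted q (result p s)"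
| "emitted (If c p q) s = (if holds c s then emitted p s else emitted q s)"
| "emitted (While c p) s = []"

primrec bits :: "prog \<Rightarrow> state \<Rightarrow> nat" where
  "bits Skip s = 1"
| "bits (Const i c) s = numlen c"
| "bits (Move i j) s = numlen (s j)"
| "bits (Op i f j k) s = op_bits f (s j) (s k)"
| "bits (Emit i) s = numlen (s i)"
| "bits (Seq p q) s = bits p s + bits q (result p s)"
| "bits (If c p q) s = test_bits c s + (if holds c s then bits p s else bits q s)"
| "bits (While c p) s = 0"

text \<open>One number bounds both the instruction count and the exponent of the growth in length. A
  constant weighs its length because \<open>numlen c <= 2 ^ numlen c\<close>.\<close>

primrec weight :: "prog \<Rightarrow> nat" where
  "weight Skip = 1"
| "weight (Const i c) = numlen c"
| "weight (Move i j) = 1"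
| "weight (Op i f j k) = 1"
| "weight (Emit i) = 1"
| "weight (Seq p q) = weight p + weight q"
| "weight (If c p q) = Suc (weight p + weight q)"
| "weight (While c p) = 0"

text \<open>An instruction at most doubles the maximal length of the registers, so that
  programs without loops need no bookkeeping of the word size.\<close>

lemma loop_free_exec:
  assumes "loop_free p" "\<And>i. numlen (s i) \<le> w"
  shows "\<exists>t. exec (2 ^ weight p * w) p s (emitted p s) t (bits p s) (result p s) \<and> t \<le> weight p
    \<and> (\<forall>i. numlen (result p s i) \<le> 2 ^ weight p * w)"
  using assms
proof (induction p arbitrary: s w)
  case Skip
  have "w \<le> 2 * w" by simp
  then have "numlen (s i) \<le> 2 * w" for i using Skip(2)[of i] by linarith
  then show ?case using exec_Skip[of "2 * w" s] by auto
next
  case (Const i c)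
  have w: "1 \<le> w" using Const(2) numlen_ge_1 le_trans by blast
  have "w * numlen c \<le> w * 2 ^ numlen c"
    by (intro mult_le_mono) (auto simp: less_imp_le)
  moreover have "1 * numlen c \<le> w * numlen c" using w by (intro mult_le_mono) auto
  ultimately have c: "numlen c \<le> 2 ^ numlen c * w"
    unfolding nat_mult_1 mult.commute[of w "2 ^ numlen c"] by (rule le_trans[rotated])
  have "numlen (s j) \<le> 2 ^ numlen c * w" for j
    using Const(2)[of j] by (metis le_trans mult_le_mono1 nat_mult_1 one_le_numeral one_le_power)
  then have "numlen (result (Const i c) s j) \<le> 2 ^ numlen c * w" for j using c by simp
  moreover have "exec (2 ^ numlen c * w) (Const i c) s [] 1 (bits (Const i c) s) (result (Const i c) s)"
    using exec_Const[OF c, of i s] by simp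
  ultimately show ?case
    unfolding weight.simps emitted.simps using numlen_ge_1[of c] by blast
next
  case (Move i j)
  have w: "numlen (s k) \<le> 2 * w" for k using Move(2)[of k] by linarith
  then have "numlen (result (Move i j) s k) \<le> 2 * w" for k by simp
  moreover have "exec (2 * w) (Move i j) s [] 1 (bits (Move i j) s) (result (Move i j) s)"
    using exec_Move[of s j "2 * w" i] w by simp
  ultimately show ?case
    unfolding weight.simps emitted.simps power_one_right by blast
next
  case (Op i f j k)
  have w: "numlen (s l) \<le> 2 * w" for l using Op(2)[of l] by linarith
  have v: "numlen (apply_op f (s j) (s k)) \<le> 2 * w"
    using numlen_apply_op[of f "s j" "s k"] Op(2)[of j] Op(2)[of k] by linarith
  from w v have "numlen (result (Op i f j k) s l) \<le> 2 * w" for l by simp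
  moreover have "exec (2 * w) (Op i f j k) s [] 1 (bits (Op i f j k) s) (result (Op i f j k) s)"
    using exec_Op[of f s j k "2 * w" i] v by simp
  ultimately show ?case
    unfolding weight.simps emitted.simps power_one_right by blast
next
  case (Emit i)
  have "numlen (s k) \<le> 2 * w" for k using Emit(2)[of k] by linarith
  then show ?case by (auto intro!: exI exec_Emit)
next
  case (Seq p q)
  obtain t1 where 1: "exec (2 ^ weight p * w) p s (emitted p s) t1 (bits p s) (result p s)"
    "t1 \<le> weight p" "\<And>i. numlen (result p s i) \<le> 2 ^ weight p * w"
    using Seq.IH(1)[of s w] Seq.prems by auto
  obtain t2 where 2: "exec (2 ^ weight q * (2 ^ weight p * w)) q (result p s)
      (emitted q (result p s)) t2 (bits q (result p s)) (result q (result p s))"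
    "t2 \<le> weight q" "\<And>i. numlen (result q (result p s) i) \<le> 2 ^ weight q * (2 ^ weight p * w)"
    using Seq.IH(2)[of "result p s" "2 ^ weight p * w"] 1(3) Seq.prems by auto
  have "exec (2 ^ weight q * (2 ^ weight p * w)) p s (emitted p s) t1 (bits p s) (result p s)"
    using 1(1) by (rule exec_mono_width) simp
  from exec_Seq[OF this 2(1)] show ?case
    using 1(2) 2(2,3) by - (rule exI[of _ "t1 + t2"], simp add: power_add mult_ac)
next
  case (If c p q)
  define p' where "p' = (if holds c s then p else q)"
  obtain t where t: "exec (2 ^ weight p' * w) p' s (emitted p' s) t (bits p' s) (result p' s)"
    "t \<le> weight p'" "\<And>i. numlen (result p' s i) \<le> 2 ^ weight p' * w"
    using If.IH(1)[of s w] If.IH(2)[of s w] If.prems unfolding p'_def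
    by (cases "holds c s") auto
  have le: "2 ^ weight p' * w \<le> 2 ^ weight (prog.If c p q) * w"
    by (intro mult_le_mono power_increasing) (auto simp: p'_def)
  have "exec (2 ^ weight (prog.If c p q) * w) p' s (emitted p' s) t (bits p' s) (result p' s)"
    using t(1) le by (rule exec_mono_width)
  then have "exec (2 ^ weight (prog.If c p q) * w) (prog.If c p q) s (emitted (prog.If c p q) s)
      (Suc t) (bits (prog.If c p q) s) (result (prog.If c p q) s)"
    using exec_If_true[of c s _ p _ _ _ _ q] exec_If_false[of c s _ q _ _ _ _ p]
    by (cases "holds c s") (simp_all add: p'_def)
  moreover have "numlen (result (prog.If c p q) s i) \<le> 2 ^ weight (prog.If c p q) * w" for i
    using t(3)[of i, THEN le_trans, OF le] by (cases "holds c s") (simp_all add: p'_def)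
  moreover have "Suc t \<le> weight (prog.If c p q)" using t(2) by (simp add: p'_def split: if_splits)
  ultimately show ?case by blast
next
  case (While c p)
  then show ?case by simp
qed

section \<open>Expressions and their compilation\<close>

datatype exp = Var reg | Num nat | Bin operation exp exp | IfLess exp exp exp exp

primrec val :: "exp \<Rightarrow> state \<Rightarrow> nat" where
  "val (Var i) s = s i"
| "val (Num c) s = c"
| "val (Bin f e1 e2) s = apply_op f (val e1 s) (val e2 s)"
| "val (IfLess a b e1 e2) s = (if val a s < val b s then val e1 s else val e2 s)"

primrec vars_below :: "reg \<Rightarrow> exp \<Rightarrow> bool" where
  "vars_below d (Var i) \<longleftrightarrow> i < d"
| "vars_below d (Num c) \<longleftrightarrow> True"
| "vars_below d (Bin f e1 e2) \<longleftrightarrow> vars_below d e1 \<and> vars_below d e2"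
| "vars_below d (IfLess a b e1 e2) \<longleftrightarrow>
    vars_below d a \<and> vars_below d b \<and> vars_below d e1 \<and> vars_below d e2"

text \<open>The number of stack registers needed: a second operand is evaluated while one register
  holds the first. The branches of a conditional start again at the bottom, since the compared
  values are dead by then.\<close>

primrec depth :: "exp \<Rightarrow> nat" where
  "depth (Var i) = 1"
| "depth (Num c) = 1"
| "depth (Bin f e1 e2) = max (depth e1) (Suc (depth e2))"
| "depth (IfLess a b e1 e2) = Max {depth a, Suc (depth b), depth e1, depth e2}"

text \<open>The registers from \<open>d\<close> on serve as a stack; the value is left in register \<open>d\<close>.\<close>

primrec compile :: "exp \<Rightarrow> reg \<Rightarrow> prog" where
  "compile (Var i) d = Move d i"
| "compile (Num c) d = Const d c"
| "compile (Bin f e1 e2) d = Seq (compile e1 d) (Seq (compile e2 (Suc d)) (Op d f d (Suc d)))"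
| "compile (IfLess a b e1 e2) d =
    Seq (compile a d) (Seq (compile b (Suc d))
      (If (Less d (Suc d)) (compile e1 d) (compile e2 d)))"

lemma loop_free_compile: "loop_free (compile e d)"
  by (induction e arbitrary: d) auto

lemma emitted_compile: "emitted (compile e d) s = []"
  by (induction e arbitrary: d s) auto

lemma vars_below_mono: "vars_below d e \<Longrightarrow> d \<le> d' \<Longrightarrow> vars_below d' e"
  by (induction e) auto

lemma val_cong: "vars_below d e \<Longrightarrow> (\<And>i. i < d \<Longrightarrow> s i = s' i) \<Longrightarrow> val e s = val e s'"
  by (induction e) auto

lemma result_compile:
  "vars_below d e \<Longrightarrow> result (compile e d) s d = val e s \<and>
    (\<forall>i. i < d \<or> d + depth e \<le> i \<longrightarrow> result (compile e d) s i = s i)"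
proof (induction e arbitrary: d s)
  case (Bin f e1 e2)
  define s1 where "s1 = result (compile e1 d) s"
  define s2 where "s2 = result (compile e2 (Suc d)) s1"
  have 1: "s1 d = val e1 s" "\<And>i. i < d \<or> d + depth e1 \<le> i \<Longrightarrow> s1 i = s i"
    using Bin.IH(1)[of d s] Bin.prems by (auto simp: s1_def)
  have v: "vars_below (Suc d) e2" using Bin.prems vars_below_mono[of d e2] by simp
  have 2: "s2 (Suc d) = val e2 s1" "\<And>i. i < Suc d \<or> Suc d + depth e2 \<le> i \<Longrightarrow> s2 i = s1 i"
    using Bin.IH(2)[OF v, of s1] by (auto simp: s2_def)
  have "val e2 s1 = val e2 s" using Bin.prems 1(2) by (intro val_cong[of d]) auto
  then show ?case using 1 2 by (auto simp: s1_def[symmetric] s2_def[symmetric])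
next
  case (IfLess a b e1 e2)
  define s1 where "s1 = result (compile a d) s"
  define s2 where "s2 = result (compile b (Suc d)) s1"
  have 1: "s1 d = val a s" "\<And>i. i < d \<or> d + depth a \<le> i \<Longrightarrow> s1 i = s i"
    using IfLess.IH(1)[of d s] IfLess.prems by (auto simp: s1_def)
  have v: "vars_below (Suc d) b" using IfLess.prems vars_below_mono[of d b] by simp
  have 2: "s2 (Suc d) = val b s1" "\<And>i. i < Suc d \<or> Suc d + depth b \<le> i \<Longrightarrow> s2 i = s1 i"
    using IfLess.IH(2)[OF v, of s1] by (auto simp: s2_def)
  have "val b s1 = val b s" using IfLess.prems 1(2) by (intro val_cong[of d]) auto
  then have 3: "s2 d = val a s" "s2 (Suc d) = val b s" using 1 2 by auto
  have 4: "s2 i = s i" if "i < d \<or> d + depth (IfLess a b e1 e2) \<le> i" for i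
  proof -
    have "depth a \<le> depth (IfLess a b e1 e2)" "Suc (depth b) \<le> depth (IfLess a b e1 e2)"
      by auto
    then have "i < d \<or> d + depth a \<le> i" "i < Suc d \<or> Suc d + depth b \<le> i"
      using that by linarith+
    then show ?thesis using 1(2)[of i] 2(2)[of i] by simp
  qed
  have 5: "val e1 s2 = val e1 s" "val e2 s2 = val e2 s"
    using IfLess.prems 4 by (auto intro!: val_cong[of d])
  define e where "e = (if val a s < val b s then e1 else e2)"
  have "result (compile (IfLess a b e1 e2) d) s = result (compile e d) s2"
    using 3 by (simp add: e_def s1_def[symmetric] s2_def[symmetric])
  moreover have "result (compile e d) s2 d = val e s2 \<and>
      (\<forall>i. i < d \<or> d + depth e \<le> i \<longrightarrow> result (compile e d) s2 i = s2 i)"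
    using IfLess.IH(3)[of d s2] IfLess.IH(4)[of d s2] IfLess.prems by (simp add: e_def)
  moreover have "val e s2 = val (IfLess a b e1 e2) s" using 5 by (simp add: e_def)
  moreover have "depth e \<le> depth (IfLess a b e1 e2)" by (simp add: e_def le_max_iff_disj)
  ultimately show ?case using 4 by (metis add_le_cancel_left le_trans)
qed auto

primrec clear :: "reg list \<Rightarrow> prog" where
  "clear [] = Skip"
| "clear (i # is) = Seq (Const i 0) (clear is)"

lemma loop_free_clear: "loop_free (clear l)"
  by (induction l) auto

lemma emitted_clear: "emitted (clear l) s = []"
  by (induction l arbitrary: s) auto

lemma result_clear: "result (clear l) s = (\<lambda>i. if i \<in> set l then 0 else s i)"
  by (induction l arbitrary: s) (auto simp: fun_eq_iff)

text \<open>The registers from 40 on are kept at zero outside of the evaluation of expressions.\<close>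

definition assign :: "reg \<Rightarrow> exp \<Rightarrow> prog" where
  "assign d e = Seq (compile e 40) (Seq (Move d 40) (clear [40..<40 + depth e]))"

lemma depth_pos: "0 < depth e"
  by (induction e) auto

lemma loop_free_assign: "loop_free (assign d e)"
  by (simp add: assign_def loop_free_compile loop_free_clear)

lemma emitted_assign: "emitted (assign d e) s = []"
  by (simp add: assign_def emitted_compile emitted_clear)

text \<open>Clearing the stack makes an assignment a plain function update, so that states can later
  be compared with \<open>input_state\<close> by equality.\<close>

lemma result_assign:
  assumes "vars_below 40 e" "d < 40" "\<And>i. 40 \<le> i \<Longrightarrow> s i = 0"
  shows "result (assign d e) s = s(d := val e s)"
proof
  fix i
  show "result (assign d e) s i = (s(d := val e s)) i"
    using result_compile[OF assms(1), of s] assms(2) assms(3)[of i] depth_pos[of e]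
    by (auto simp: assign_def result_clear)
qed

section \<open>The extended Euclidean algorithm\<close>

lemma numlen_double:
  assumes "2 * x \<le> y" "0 < y"
  shows "Suc (numlen x) \<le> numlen y"
proof -
  have "\<not> numlen y \<le> Suc (floorlog 2 x)"
  proof
    assume "numlen y \<le> Suc (floorlog 2 x)"
    then have y: "y < 2 ^ floorlog 2 x" by (simp only: numlen_le_Suc_iff)
    show False
    proof (cases "x = 0")
      case True
      then show False using y assms by (simp add: floorlog_def)
    next
      case False
      then have "2 ^ (floorlog 2 x - 1) \<le> x" "0 < floorlog 2 x"
        using floorlog_bounds[of x 2] floorlog_eq_zero_iff[of 2 x] by auto
      then show False using y assms by (cases "floorlog 2 x") auto
    qed
  qed
  then show ?thesis by (simp add: numlen_def)
qed

text \<open>The leading powers of two of quotient and divisor multiply to at most \<open>x\<close>.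
  Hence multiplying a coefficient by the quotient is paid by the same digit count as the division
  that produced it.\<close>

lemma numlen_div:
  assumes "0 < y" "y \<le> x"
  shows "numlen (x div y) \<le> numlen x - numlen y + 2"
proof -
  let ?q = "x div y"
  have q: "0 < ?q" using assms by (simp add: div_greater_zero_iff)
  have "2 ^ (floorlog 2 ?q - 1) * 2 ^ (floorlog 2 y - 1) \<le> ?q * y"
    using floorlog_bounds[of ?q 2] floorlog_bounds[of y 2] q assms by (intro mult_le_mono) auto
  also have "\<dots> \<le> x" by simp
  also have "x < 2 ^ floorlog 2 x" using floorlog_bounds[of x 2] assms by auto
  finally have "(floorlog 2 ?q - 1) + (floorlog 2 y - 1) < floorlog 2 x"
    by (simp add: power_add[symmetric])
  moreover have "floorlog 2 y \<le> floorlog 2 x" using assms by (intro floorlog_mono)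
  ultimately show ?thesis by (simp add: numlen_def)
qed

text \<open>Registers 10 and 11 hold consecutive remainders, 12 and 13
  the absolute values of their coefficients of \<open>a1\<close>, and 14 the signs.\<close>

definition euclid_body :: prog where
  "euclid_body =
    Seq (Op 15 Divide 10 11) (Seq (Op 16 Modulo 10 11) (Seq (Move 10 11) (Seq (Move 11 16)
    (Seq (Op 16 Times 15 13) (Seq (Op 16 Plus 12 16) (Seq (Move 12 13) (Seq (Move 13 16)
    (Op 14 Minus 17 14))))))))"

definition euclid_init :: prog where
  "euclid_init = Seq (Move 10 0) (Seq (Move 11 1) (Seq (Const 13 1) (Const 17 1)))"

text \<open>The signs of the Bezout coefficients alternate, so absolute values and one sign bit,
  toggled as \<open>1 - s 14\<close>, replace signed arithmetic. The equation
  \<open>s 13 * s 10 + s 12 * s 11 = n\<close> is the determinant identity of continued fractions;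
  it keeps the coefficients below \<open>n\<close>. The zero registers supply the constant 0 of the
  loop test and the clean state that planning expects.\<close>

definition euclid_inv :: "nat \<Rightarrow> nat \<Rightarrow> nat \<Rightarrow> state \<Rightarrow> bool" where
  "euclid_inv n a1 a2 s \<longleftrightarrow> s 0 = n \<and> s 1 = a1 \<and> s 2 = a2 \<and> s 17 = 1 \<and>
    (\<forall>i. i \<in> {3..<10} \<or> 18 \<le> i \<longrightarrow> s i = 0) \<and> (\<forall>i. s i \<le> n) \<and>
    s 11 \<le> s 10 \<and> 0 < s 10 \<and> gcd (s 10) (s 11) = gcd n a1 \<and>
    s 13 * s 10 + s 12 * s 11 = n \<and> s 12 \<le> s 13 \<and> s 14 \<le> 1 \<and>
    (if s 14 = 0 then [s 11 = s 13 * a1] (mod n) \<and> [s 10 + s 12 * a1 = 0] (mod n)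
     else [s 11 + s 13 * a1 = 0] (mod n) \<and> [s 10 = s 12 * a1] (mod n))"

lemma euclid_init:
  assumes "1 \<le> a1" "a1 \<le> n" "a2 \<le> n"
  shows "euclid_inv n a1 a2 (result euclid_init (input_state [n, a1, a2]))"
proof -
  have s: "result euclid_init (input_state [n, a1, a2]) =
      (\<lambda>i. if i = 0 \<or> i = 10 then n else if i = 1 \<or> i = 11 then a1 else if i = 2 then a2
        else if i = 13 \<or> i = 17 then 1 else 0)"
    by (auto simp: euclid_init_def input_state_def fun_eq_iff numeral_2_eq_2 less_Suc_eq)
  show ?thesis using assms by (auto simp: euclid_inv_def s cong_def)
qed

lemma result_euclid_body:
  "result euclid_body s = s(15 := s 10 div s 11, 16 := s 12 + s 10 div s 11 * s 13,
    10 := s 11, 11 := s 10 mod s 11, 12 := s 13, 13 := s 12 + s 10 div s 11 * s 13,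
    14 := s 17 - s 14)"
  by (auto simp: euclid_body_def fun_eq_iff)

lemma euclid_inv_body:
  assumes inv: "euclid_inv n a1 a2 s" and pos: "0 < s 11"
  shows "euclid_inv n a1 a2 (result euclid_body s)"
proof -
  define x0 x1 p0 p1 where "x0 = s 10" "x1 = s 11" "p0 = s 12" "p1 = s 13"
  define q where "q = x0 div x1"
  note defs = x0_x1_p0_p1_def
  have x: "x1 \<le> x0" "0 < x1" "gcd x0 x1 = gcd n a1" "p1 * x0 + p0 * x1 = n" "p0 \<le> p1"
    and s: "s 0 = n" "s 1 = a1" "s 2 = a2" "s 17 = 1" "\<And>i. i \<in> {3..<10} \<or> 18 \<le> i \<Longrightarrow> s i = 0"
      "\<And>i. s i \<le> n" "s 14 \<le> 1"
    and c: "if s 14 = 0 then [x1 = p1 * a1] (mod n) \<and> [x0 + p0 * a1 = 0] (mod n)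
       else [x1 + p1 * a1 = 0] (mod n) \<and> [x0 = p0 * a1] (mod n)"
    using inv pos by (auto simp: euclid_inv_def defs)
  have x0: "x0 = x1 * q + x0 mod x1" by (simp add: q_def)
  have q: "1 \<le> q" unfolding q_def using x by (simp add: Suc_le_eq div_greater_zero_iff)
  have n': "(p0 + q * p1) * x1 + p1 * (x0 mod x1) = n"
  proof -
    have "p1 * x0 = p1 * (x1 * q) + p1 * (x0 mod x1)" by (subst x0) (rule distrib_left)
    then show ?thesis using x(4) by (simp add: algebra_simps)
  qed
  \<comment> \<open>The new coefficient is multiplied by \<open>x1 >= 1\<close> in the identity,
    whose value is still \<open>n\<close>.\<close>
  have le: "p0 + q * p1 \<le> n"
  proof -
    have "(p0 + q * p1) * 1 \<le> (p0 + q * p1) * x1" using x by (intro mult_le_mono) auto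
    then have "p0 + q * p1 \<le> (p0 + q * p1) * x1" by (simp only: mult_1_right)
    also have "\<dots> \<le> n" unfolding n'[symmetric] by (rule le_add1)
    finally show ?thesis .
  qed
  have "1 * p1 \<le> q * p1" using q by (intro mult_le_mono) auto
  then have p: "p1 \<le> p0 + q * p1" by linarith
  have lt: "x0 mod x1 \<le> x1" using x by (simp add: less_imp_le)
  have qn: "q \<le> n"
  proof -
    have "q \<le> x0" by (simp add: q_def)
    then show ?thesis using s(6)[of 10] by (simp add: defs)
  qed
  have g: "gcd x1 (x0 mod x1) = gcd n a1" using x(3) by (metis gcd.commute gcd_red_nat)
  have c': "if 1 - s 14 = 0 then [x0 mod x1 = (p0 + q * p1) * a1] (mod n) \<and> [x1 + p1 * a1 = 0] (mod n)
       else [x0 mod x1 + (p0 + q * p1) * a1 = 0] (mod n) \<and> [x1 = p1 * a1] (mod n)"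
  proof (cases "s 14 = 0")
    case True
    then have c1: "[x1 = p1 * a1] (mod n)" and c2: "[x0 + p0 * a1 = 0] (mod n)" using c by auto
    have "[x0 mod x1 + (p0 + q * p1) * a1 = x0 mod x1 + p0 * a1 + q * (p1 * a1)] (mod n)"
      by (simp add: algebra_simps)
    also have "[x0 mod x1 + p0 * a1 + q * (p1 * a1) = x0 mod x1 + p0 * a1 + q * x1] (mod n)"
      by (intro cong_add cong_mult cong_refl cong_sym[OF c1])
    also have "x0 mod x1 + p0 * a1 + q * x1 = x0 + p0 * a1"
      using x0 mult.commute[of q x1] by linarith
    also have "[x0 + p0 * a1 = 0] (mod n)" by (rule c2)
    finally show ?thesis using True c1 by simp
  next
    case False
    then have c1: "[x1 + p1 * a1 = 0] (mod n)" and c2: "[x0 = p0 * a1] (mod n)" using c by auto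
    have "[x0 mod x1 + q * x1 = p0 * a1] (mod n)"
      using c2 x0 by (simp add: mult.commute add.commute)
    \<comment> \<open>Adding a multiple of a sum that vanishes modulo \<open>n\<close> replaces the
      subtraction of \<open>q * x1\<close>.\<close>
    moreover have "[q * (x1 + p1 * a1) = 0] (mod n)" using cong_mult[OF cong_refl c1, of q] by simp
    ultimately have "[x0 mod x1 + q * x1 + 0 = p0 * a1 + q * (x1 + p1 * a1)] (mod n)"
      by (intro cong_add) (simp_all add: cong_sym)
    then have "[x0 mod x1 + q * x1 = (p0 + q * p1) * a1 + q * x1] (mod n)"
      by (simp add: algebra_simps)
    then have "[x0 mod x1 = (p0 + q * p1) * a1] (mod n)" by (simp only: cong_add_rcancel_nat)
    then show ?thesis using False s(7) c1 by simp
  qed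
  have s': "result euclid_body s = s(15 := q, 16 := p0 + q * p1, 10 := x1, 11 := x0 mod x1,
      12 := p1, 13 := p0 + q * p1, 14 := 1 - s 14)"
    by (simp add: result_euclid_body defs q_def s)
  have x1n: "x1 \<le> n" "p1 \<le> n" using s(6)[of 11] s(6)[of 13] by (simp_all add: defs)
  have "x0 mod x1 \<le> n" using lt x1n by linarith
  then have bd: "result euclid_body s i \<le> n" for i
  proof -
    have "1 - s 14 \<le> n" using s(6)[of 17] s(4) by linarith
    then show ?thesis using s(6)[of i] \<open>x0 mod x1 \<le> n\<close> le qn x1n by (simp add: s')
  qed
  show ?thesis
    unfolding euclid_inv_def using bd c' n' p x lt g s by (simp add: s')
qed

lemma bits_euclid_body:
  assumes inv: "euclid_inv n a1 a2 s" and pos: "0 < s 11"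
  shows "bits euclid_body s \<le> 14 * numlen n * Suc (numlen (s 10) - numlen (s 11))"
proof -
  define N d where "N = numlen n" "d = numlen (s 10) - numlen (s 11)"
  define q where "q = s 10 div s 11"
  have le: "numlen (s i) \<le> N" "numlen (result euclid_body s i) \<le> N" for i
    using inv euclid_inv_body[OF inv pos] by (auto simp: N_d_def euclid_inv_def intro: numlen_mono)
  have new: "numlen (s 12 + q * s 13) \<le> N" "numlen (s 10 mod s 11) \<le> N" "numlen (s 13) \<le> N"
    using le(2)[of 13] le(2)[of 11] le(1)[of 13] by (simp_all add: result_euclid_body q_def)
  have qp: "numlen (q * s 13) \<le> N" using numlen_mono[of "q * s 13" "s 12 + q * s 13"] new by simp
  have "numlen q \<le> d + 2"
    unfolding q_def N_d_def using inv pos by (intro numlen_div) (auto simp: euclid_inv_def)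
  note facts = this new qp le(1)
  have "bits euclid_body s =
      2 * (numlen (s 10) + numlen (s 11) * Suc d) + numlen (s 11) + numlen (s 10 mod s 11)
      + numlen q * numlen (s 13) + (numlen (s 12) + numlen (q * s 13)) + numlen (s 13)
      + numlen (s 12 + q * s 13) + (numlen (s 17) + numlen (s 14))"
    by (simp add: euclid_body_def N_d_def q_def)
  also have "\<dots> \<le> 2 * (N + N * Suc d) + N + N + (d + 2) * N + (N + N) + N + N + (N + N)"
    by (intro add_mono mult_le_mono le_refl facts)
  \<comment> \<open>The sum is \<open>14 * N + 3 * N * d\<close>.\<close>
  also have "\<dots> \<le> 14 * N * Suc d" by (simp add: algebra_simps)
  finally show ?thesis by (simp add: N_d_def)
qed

text \<open>The cost of the long divisions telescopes.\<close>

lemma euclid_loop: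
  assumes "euclid_inv n a1 a2 s"
  defines "W \<equiv> 2 ^ weight euclid_body * numlen n"
  shows "\<exists>t b s'. exec W (While (Less 18 11) euclid_body) s [] t b s' \<and>
    euclid_inv n a1 a2 s' \<and> s' 11 = 0 \<and>
    t \<le> Suc (weight euclid_body) * Suc (2 * numlen (s 10) + numlen (s 11)) \<and>
    b \<le> 16 * numlen n * Suc (2 * numlen (s 10) + numlen (s 11))"
  using assms(1)
proof (induction "s 11" arbitrary: s rule: less_induct)
  case less
  define N where "N = numlen n"
  have s18: "s 18 = 0" and le: "\<And>i. numlen (s i) \<le> N" and x: "s 11 \<le> s 10" "0 < s 10"
    using less(2) by (auto simp: euclid_inv_def N_def intro: numlen_mono)
  have N1: "1 \<le> N" using numlen_ge_1 by (simp add: N_def)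
  \<comment> \<open>The potential drops in each round by at least \<open>d + 1\<close>, the number
    of quotient digits that the round pays for, where \<open>d\<close> is the difference of the
    lengths of dividend and divisor. The factor 16 is 14 for the body and 2 for the test.\<close>
  let ?\<Phi> = "\<lambda>s :: state. 2 * numlen (s 10) + numlen (s 11)"
  show ?case
  proof (cases "s 11 = 0")
    case True
    have "exec W (While (Less 18 11) euclid_body) s [] 1 (test_bits (Less 18 11) s) s"
      using True s18 by (intro exec_While_false) simp
    moreover have "test_bits (Less 18 11) s \<le> 16 * N * Suc (?\<Phi> s)" using N1 True s18 by simp
    moreover have "1 \<le> Suc (weight euclid_body) * Suc (?\<Phi> s)" by simp
    ultimately show ?thesis using True less(2) unfolding N_def by blast
  next
    case False
    define s1 where "s1 = result euclid_body s"
    define d where "d = numlen (s 10) - numlen (s 11)"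
    have inv1: "euclid_inv n a1 a2 s1"
      unfolding s1_def using less(2) False by (intro euclid_inv_body) auto
    have s1: "s1 10 = s 11" "s1 11 = s 10 mod s 11"
      by (simp_all add: s1_def result_euclid_body)
    have lt: "s1 11 < s 11" using False s1 by simp
    obtain t2 b2 s' where IH: "exec W (While (Less 18 11) euclid_body) s1 [] t2 b2 s'"
      "euclid_inv n a1 a2 s'" "s' 11 = 0"
      "t2 \<le> Suc (weight euclid_body) * Suc (?\<Phi> s1)" "b2 \<le> 16 * N * Suc (?\<Phi> s1)"
      using less(1)[OF lt inv1] by (auto simp: N_def)
    obtain t1 where t1: "exec W euclid_body s [] t1 (bits euclid_body s) s1" "t1 \<le> weight euclid_body"
      using loop_free_exec[of euclid_body s N] le
      by (auto simp: euclid_body_def W_def N_def s1_def)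
    have ex: "exec W (While (Less 18 11) euclid_body) s ([] @ []) (Suc (t1 + t2))
        (test_bits (Less 18 11) s + bits euclid_body s + b2) s'"
      using False s18 by (intro exec_While_true[OF _ t1(1) IH(1)]) simp
    have pot: "?\<Phi> s1 + Suc d \<le> ?\<Phi> s"
    proof -
      have l10: "numlen (s 11) \<le> numlen (s 10)" using x by (intro numlen_mono)
      have l21: "numlen (s1 11) \<le> numlen (s 11)" using lt by (intro numlen_mono) simp
      have "2 * (s 10 mod s 11) \<le> s 10"
      proof -
        have "s 11 * 1 \<le> s 11 * (s 10 div s 11)"
          using x False by (intro mult_le_mono) (auto simp: Suc_le_eq div_greater_zero_iff)
        moreover have "s 10 = s 11 * (s 10 div s 11) + s 10 mod s 11" by simp
        moreover have "s 10 mod s 11 < s 11" using False by simp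
        ultimately show ?thesis by linarith
      qed
      then have "Suc (numlen (s1 11)) \<le> numlen (s 10)" unfolding s1 using x by (intro numlen_double)
      \<comment> \<open>If the lengths agree, the remainder is shorter than the divisor by a digit;
        otherwise the doubled term gains \<open>2 * d\<close>, which is at least
        \<open>d + 1\<close>.\<close>
      then show ?thesis using l10 l21 by (cases "numlen (s 10) = numlen (s 11)") (simp_all add: d_def s1)
    qed
    have "Suc (t1 + t2) \<le> Suc (weight euclid_body) + Suc (weight euclid_body) * Suc (?\<Phi> s1)"
      using t1 IH(4) by linarith
    also have "\<dots> = Suc (weight euclid_body) * Suc (Suc (?\<Phi> s1))" by simp
    also have "\<dots> \<le> Suc (weight euclid_body) * Suc (?\<Phi> s)" using pot by (intro mult_le_mono) auto
    finally have t: "Suc (t1 + t2) \<le> Suc (weight euclid_body) * Suc (?\<Phi> s)" .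
    have "bits euclid_body s \<le> 14 * N * Suc d"
      unfolding N_def d_def using less(2) False by (intro bits_euclid_body) auto
    moreover have "test_bits (Less 18 11) s \<le> 2 * N * 1" using le[of 18] le[of 11] by simp
    moreover have "2 * N * 1 \<le> 2 * N * Suc d" by (intro mult_le_mono) auto
    ultimately have "test_bits (Less 18 11) s + bits euclid_body s + b2
        \<le> 16 * N * Suc d + 16 * N * Suc (?\<Phi> s1)"
      using IH(5) by linarith
    also have "\<dots> = 16 * N * (Suc (?\<Phi> s1 + Suc d))" by (simp add: algebra_simps)
    also have "\<dots> \<le> 16 * N * Suc (?\<Phi> s)" using pot by (intro mult_le_mono) auto
    finally have "test_bits (Less 18 11) s + bits euclid_body s + b2 \<le> 16 * N * Suc (?\<Phi> s)" .
    with ex t IH(2,3) show ?thesis unfolding N_def append_Nil by blast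
  qed
qed

text \<open>Since \<open>n - 1\<close> is \<open>-1\<close> modulo \<open>n\<close>, the factor
  \<open>n - 1\<close> realizes a negative coefficient by a natural number.\<close>

lemma euclid_bezout:
  assumes "euclid_inv n a1 a2 s" "s 11 = 0" "0 < n"
  shows "s 10 = gcd n a1" "[(if s 14 < 1 then s 12 * (n - 1) else s 12) * a1 = gcd n a1] (mod n)"
proof -
  show g: "s 10 = gcd n a1" using assms by (simp add: euclid_inv_def)
  show "[(if s 14 < 1 then s 12 * (n - 1) else s 12) * a1 = gcd n a1] (mod n)"
  proof (cases "s 14 = 0")
    case True
    moreover have "if s 14 = 0 then [s 11 = s 13 * a1] (mod n) \<and> [s 10 + s 12 * a1 = 0] (mod n)
       else [s 11 + s 13 * a1 = 0] (mod n) \<and> [s 10 = s 12 * a1] (mod n)"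
      using assms(1) unfolding euclid_inv_def by blast
    ultimately have "[s 10 + s 12 * a1 = 0] (mod n)" by (simp only: if_True simp_thms)
    moreover have "[s 12 * (n - 1) * a1 + s 12 * a1 = 0] (mod n)"
    proof -
      have "s 12 * (n - 1) * a1 + s 12 * a1 = s 12 * (n - 1 + 1) * a1" by (simp add: algebra_simps)
      also have "n - 1 + 1 = n" using assms by simp
      finally show ?thesis by (simp add: cong_0_iff)
    qed
    ultimately have "[s 12 * (n - 1) * a1 + s 12 * a1 = s 10 + s 12 * a1] (mod n)"
      by (metis cong_sym cong_trans)
    then have "[s 12 * (n - 1) * a1 = s 10] (mod n)" by (simp only: cong_add_rcancel_nat)
    then show ?thesis using True g by simp
  next
    case False
    moreover have "if s 14 = 0 then [s 11 = s 13 * a1] (mod n) \<and> [s 10 + s 12 * a1 = 0] (mod n)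
       else [s 11 + s 13 * a1 = 0] (mod n) \<and> [s 10 = s 12 * a1] (mod n)"
      using assms(1) unfolding euclid_inv_def by blast
    ultimately have "[s 10 = s 12 * a1] (mod n)" by (simp only: if_False simp_thms)
    then show ?thesis using False g by (simp add: cong_sym)
  qed
qed

section \<open>The lower bound\<close>

lemma card_inter_sum:
  "finite A \<Longrightarrow> card {i \<in> A. P i} = (\<Sum>i\<in>A. if P i then 1 else 0 :: nat)"
  by (simp add: sum.If_cases Int_def)

text \<open>Along an open path the parity of the number of changes tells whether the two ends agree;
  closing the path makes it even.\<close>

lemma even_cyclic_changes:
  fixes P :: "nat \<Rightarrow> bool"
  assumes "n > 0"
  shows "even (card {i \<in> {..<n}. P i \<noteq> P (Suc i mod n)})"
proof -
  have lin: "even (card {i \<in> {..<m}. P i \<noteq> P (Suc i)}) \<longleftrightarrow> P 0 = P m" for m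
  proof (induction m)
    case (Suc m)
    have "{i \<in> {..<Suc m}. P i \<noteq> P (Suc i)} =
      (if P m \<noteq> P (Suc m) then insert m {i \<in> {..<m}. P i \<noteq> P (Suc i)}
       else {i \<in> {..<m}. P i \<noteq> P (Suc i)})"
      by (auto simp: less_Suc_eq)
    then show ?case using Suc by auto
  qed auto
  obtain m where n: "n = Suc m" using assms gr0_conv_Suc by blast
  have "{i \<in> {..<n}. P i \<noteq> P (Suc i mod n)} =
    (if P m \<noteq> P 0 then insert m {i \<in> {..<m}. P i \<noteq> P (Suc i)}
     else {i \<in> {..<m}. P i \<noteq> P (Suc i)})"
    by (auto simp: n less_Suc_eq mod_Suc)
  then show ?thesis using lin[of m] by auto
qed

lemma cyclic_change_exists:
  fixes P :: "nat \<Rightarrow> bool"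
  assumes "i < n" "j < n" "P i" "\<not> P j"
  shows "\<exists>k<n. P k \<noteq> P (Suc k mod n)"
proof (rule ccontr)
  assume "\<not> ?thesis"
  then have eq: "P (Suc k mod n) = P k" if "k < n" for k using that by blast
  have "P k = P 0" if "k < n" for k
    using that
  proof (induction k)
    case (Suc k)
    then show ?case using eq[of k] by simp
  qed auto
  then show False using assms by blast
qed

text \<open>The residues modulo \<open>n\<close> form a twisted torus: \<open>g\<close> columns, the cycles of the edges of
  length \<open>a1\<close>, are joined by edges of length \<open>a2\<close>; those from the last to the first column,
  the seam, shift the rows by \<open>t\<close>.\<close>

locale torus =
  fixes n a1 a2 g r t :: nat and col row :: "nat \<Rightarrow> nat"
  assumes n: "n = g * r" and g2: "2 \<le> g" and r2: "2 \<le> r" and t: "t < r"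
    and col: "v < n \<Longrightarrow> col v < g" and row: "v < n \<Longrightarrow> row v < r"
    and inj: "v < n \<Longrightarrow> w < n \<Longrightarrow> col v = col w \<Longrightarrow> row v = row w \<Longrightarrow> v = w"
    and surj: "i < g \<Longrightarrow> x < r \<Longrightarrow> \<exists>v<n. col v = i \<and> row v = x"
    and col_a1: "v < n \<Longrightarrow> col ((v + a1) mod n) = col v"
    and row_a1: "v < n \<Longrightarrow> row ((v + a1) mod n) = Suc (row v) mod r"
    and col_a2: "v < n \<Longrightarrow> col ((v + a2) mod n) = Suc (col v) mod g"
    and row_a2: "v < n \<Longrightarrow> row ((v + a2) mod n) = (if Suc (col v) < g then row v else (row v + t) mod r)"
begin

lemma n4: "4 \<le> n"
  using mult_le_mono[OF g2 r2] n by simp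

end

text \<open>The cyclic successor leaves the initial segment up to \<open>k\<close> at
  \<open>k\<close> and reenters it from \<open>m - 1\<close>. This serves for columns and for
  rows.\<close>

lemma prefix_change:
  fixes x y m k :: nat
  assumes "x < m" "k < m - 1"
  shows "((x \<le> k) \<noteq> (Suc x mod m \<le> k)) \<longleftrightarrow> x = k \<or> x = m - 1"
  using assms by (cases "Suc x = m") auto

locale finite_tour = torus +
  fixes ys :: "nat list"
  assumes len: "length ys = n" and tour: "distinct ys" "set ys = {..<n}"
    and fin: "i < n \<Longrightarrow> stripe_edge n a1 (ys ! i) (ys ! (Suc i mod n)) \<or>
      stripe_edge n a2 (ys ! i) (ys ! (Suc i mod n))"
begin

definition cur :: "nat \<Rightarrow> nat" where "cur i = ys ! i"
definition nxt :: "nat \<Rightarrow> nat" where "nxt i = ys ! (Suc i mod n)"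

definition ver :: "nat \<Rightarrow> bool" where "ver i \<longleftrightarrow> stripe_edge n a1 (cur i) (nxt i)"

text \<open>The direction in which the tour runs through an edge is forgotten: each edge is oriented
  from \<open>base\<close> to \<open>other\<close> by adding \<open>a1\<close> or \<open>a2\<close>.
  Counting crossings needs only the unordered pair of ends.\<close>

definition base :: "nat \<Rightarrow> nat" where
  "base i = (if (cur i + (if ver i then a1 else a2)) mod n = nxt i then cur i else nxt i)"

definition other :: "nat \<Rightarrow> nat" where
  "other i = (base i + (if ver i then a1 else a2)) mod n"

lemma cur_less: "i < n \<Longrightarrow> cur i < n"
  using tour len nth_mem[of i ys] by (auto simp: cur_def)

lemma nxt_eq: "nxt i = cur (Suc i mod n)"
  by (simp add: cur_def nxt_def)

lemma nxt_less: "nxt i < n"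
  using n4 by (auto simp: nxt_eq intro!: cur_less)

lemma base_less: "i < n \<Longrightarrow> base i < n"
  by (simp add: base_def cur_less nxt_less)

lemma cur_inj: "i < n \<Longrightarrow> j < n \<Longrightarrow> cur i = cur j \<Longrightarrow> i = j"
  using tour len by (simp add: cur_def nth_eq_iff_index_eq)

lemma base_cases:
  assumes "i < n"
  obtains "base i = cur i" "other i = nxt i" | "base i = nxt i" "other i = cur i"
proof -
  have "stripe_edge n (if ver i then a1 else a2) (cur i) (nxt i)"
    using fin[OF assms] by (auto simp: ver_def cur_def nxt_def)
  then show thesis
    by (cases "(cur i + (if ver i then a1 else a2)) mod n = nxt i")
      (simp_all add: that stripe_edge_def base_def other_def)
qed

lemma change_cong:
  fixes P :: "nat \<Rightarrow> bool"
  assumes "i < n"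
  shows "(P (cur i) \<noteq> P (nxt i)) \<longleftrightarrow> (P (base i) \<noteq> P (other i))"
  using assms by (rule base_cases) auto

lemma even_crossings:
  fixes P :: "nat \<Rightarrow> bool"
  shows "even (card {i \<in> {..<n}. P (base i) \<noteq> P (other i)})"
proof -
  have "{i \<in> {..<n}. P (base i) \<noteq> P (other i)} =
    {i \<in> {..<n}. P (cur i) \<noteq> P (cur (Suc i mod n))}"
    using change_cong[of _ P] by (auto simp: nxt_eq)
  then show ?thesis using even_cyclic_changes[of n "\<lambda>i. P (cur i)"] n4 by simp
qed

lemma crossing_exists:
  fixes P :: "nat \<Rightarrow> bool"
  assumes "v < n" "w < n" "P v" "\<not> P w"
  shows "\<exists>i<n. P (base i) \<noteq> P (other i)"
proof -
  obtain i j where "i < n" "cur i = v" "j < n" "cur j = w"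
    using assms tour len by (metis cur_def in_set_conv_nth lessThan_iff)
  then obtain k where "k < n" "P (cur k) \<noteq> P (cur (Suc k mod n))"
    using cyclic_change_exists[of i n j "\<lambda>i. P (cur i)"] assms by auto
  then show ?thesis using change_cong[of k P] by (auto simp: nxt_eq)
qed

definition gap :: "nat \<Rightarrow> nat" where
  "gap k = card {i \<in> {..<n}. \<not> ver i \<and> col (base i) = k}"

definition hor :: nat where "hor = card {i \<in> {..<n}. \<not> ver i}"

lemma hor_eq_sum_gap: "hor = (\<Sum>k<g. gap k)"
proof -
  have "hor = card (\<Union>k<g. {i \<in> {..<n}. \<not> ver i \<and> col (base i) = k})"
    unfolding hor_def using col base_less by (intro arg_cong[of _ _ card]) auto
  also have "\<dots> = (\<Sum>k<g. gap k)"
    unfolding gap_def by (intro card_UN_disjoint) auto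
  finally show ?thesis .
qed

lemma col_other: "i < n \<Longrightarrow> col (other i) = (if ver i then col (base i) else Suc (col (base i)) mod g)"
  by (simp add: other_def col_a1 col_a2 base_less)

lemma row_other: "i < n \<Longrightarrow> row (other i) = (if ver i then Suc (row (base i)) mod r
    else if Suc (col (base i)) < g then row (base i) else (row (base i) + t) mod r)"
  by (simp add: other_def row_a1 row_a2 base_less)

text \<open>The columns up to \<open>k\<close> are bordered by the gap after \<open>k\<close> and by
  the seam only.\<close>

lemma even_gap_add: assumes "k < g" shows "even (gap k + gap (g - 1))"
proof (cases "k = g - 1")
  case False
  then have k: "k < g - 1" using assms by simp
  have "(col (base i) \<le> k) \<noteq> (col (other i) \<le> k) \<longleftrightarrow>
    \<not> ver i \<and> (col (base i) = k \<or> col (base i) = g - 1)" if "i < n" for i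
    using prefix_change[OF col[OF base_less[OF that]] k] that by (simp add: col_other)
  then have "{i \<in> {..<n}. (col (base i) \<le> k) \<noteq> (col (other i) \<le> k)} =
    {i \<in> {..<n}. \<not> ver i \<and> col (base i) = k} \<union> {i \<in> {..<n}. \<not> ver i \<and> col (base i) = g - 1}"
    by auto
  moreover have "card \<dots> = gap k + gap (g - 1)"
    unfolding gap_def using False by (intro card_Un_disjoint) auto
  ultimately show ?thesis using even_crossings[of "\<lambda>v. col v \<le> k"] by simp
qed auto

text \<open>Two uncrossed gaps would cut the torus into two parts between which the tour could not
  pass.\<close>

lemma gap_zero_unique:
  assumes "k < l" "l < g" "gap k = 0" "gap l = 0"
  shows False
proof -
  let ?P = "\<lambda>v. k < col v \<and> col v \<le> l"
  obtain v where v: "v < n" "col v = l" using surj[of l 0] assms r2 by auto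
  obtain w where w: "w < n" "col w = k" using surj[of k 0] assms r2 by auto
  obtain i where i: "i < n" "?P (base i) \<noteq> ?P (other i)"
    using crossing_exists[of v w ?P] v w assms by auto
  have z: "\<And>i. i < n \<Longrightarrow> \<not> ver i \<Longrightarrow> col (base i) \<noteq> k \<and> col (base i) \<noteq> l"
    using assms(3,4) by (auto simp: gap_def card_eq_0_iff)
  have nv: "\<not> ver i" using i by (auto simp: col_other)
  show False
    using i nv z[OF i(1) nv] col[OF base_less[OF i(1)]] assms
    by (cases "Suc (col (base i)) = g") (auto simp: col_other)
qed

lemma even_gaps_bound:
  assumes "even (gap (g - 1))"
  shows "2 * (g - 1) \<le> hor"
proof -
  have ev: "even (gap k)" if "k < g" for k using even_gap_add[OF that] assms by simp
  have "\<exists>k0<g. \<forall>k<g. k \<noteq> k0 \<longrightarrow> gap k \<noteq> 0"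
  proof (cases "\<exists>k0<g. gap k0 = 0")
    case True
    then show ?thesis using gap_zero_unique by (metis linorder_neqE_nat)
  next
    case False
    then show ?thesis using g2 by (intro exI[of _ 0]) auto
  qed
  then obtain k0 where k0: "k0 < g" "\<And>k. k < g \<Longrightarrow> k \<noteq> k0 \<Longrightarrow> gap k \<noteq> 0" by blast
  have "2 * (g - 1) = (\<Sum>k\<in>{..<g} - {k0}. 2)" using k0 by simp
  also have "\<dots> \<le> (\<Sum>k\<in>{..<g} - {k0}. gap k)"
  proof (rule sum_mono)
    fix k assume "k \<in> {..<g} - {k0}"
    then have "even (gap k)" "gap k \<noteq> 0" using ev k0 by auto
    then show "2 \<le> gap k" by (auto elim: evenE)
  qed
  also have "\<dots> \<le> hor" unfolding hor_eq_sum_gap by (intro sum_mono2) auto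
  finally show ?thesis .
qed

lemma odd_gaps:
  assumes "odd (gap (g - 1))"
  shows "g \<le> hor" "even (hor + g)" "hor < 3 * g \<Longrightarrow> \<exists>k<g. gap k = 1"
proof -
  have od: "odd (gap k)" if "k < g" for k using even_gap_add[OF that] assms by simp
  have "g = (\<Sum>k<g. 1)" by simp
  also have "\<dots> \<le> hor" unfolding hor_eq_sum_gap using od odd_pos by (intro sum_mono) fastforce
  finally show "g \<le> hor" .
  have "even (\<Sum>k<g. gap k + 1)" using od by (intro dvd_sum) auto
  then show "even (hor + g)" unfolding hor_eq_sum_gap sum.distrib by simp
  show "\<exists>k<g. gap k = 1" if "hor < 3 * g"
  proof (rule ccontr)
    assume *: "\<not> ?thesis"
    have "3 * g = (\<Sum>k<g. 3)" by simp
    also have "\<dots> \<le> hor" unfolding hor_eq_sum_gap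
    proof (rule sum_mono)
      fix k assume "k \<in> {..<g}"
      then have "odd (gap k)" "gap k \<noteq> 1" using od * by auto
      then show "3 \<le> gap k" by (cases "gap k = 0 \<or> gap k = 2") auto
    qed
    finally show False using that by simp
  qed
qed

section \<open>Parity of the missing edges between rows\<close>

definition ups :: "nat \<Rightarrow> nat" where
  "ups x = card {i \<in> {..<n}. ver i \<and> row (base i) = x}"

text \<open>Otherwise one edge would be traversed forth and back, so \<open>i\<close> and
  \<open>j\<close> would be successors of each other, which \<open>n >= 4\<close> excludes.\<close>

lemma base_inj:
  assumes "i < n" "j < n" "ver i" "ver j" "base i = base j"
  shows "i = j"
proof (rule ccontr)
  assume ij: "i \<noteq> j"
  have sm: "Suc k mod n < n" for k using n4 by simp
  have oth: "other i = other j" using assms by (simp add: other_def)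
  have ninj: "Suc i mod n = Suc j mod n \<Longrightarrow> i = j"
    using assms by (auto simp: mod_Suc split: if_splits)
  have "cur i \<noteq> cur j" using ij assms cur_inj by blast
  moreover have "nxt i \<noteq> nxt j" using ij ninj cur_inj sm unfolding nxt_eq by blast
  ultimately have "nxt i = cur j \<and> nxt j = cur i"
    by (rule_tac base_cases[OF assms(1)]; rule_tac base_cases[OF assms(2)])
      (simp_all add: assms(5) oth)
  then have "Suc i mod n = j" "Suc j mod n = i"
    using cur_inj sm assms by (auto simp: nxt_eq)
  then show False using n4 assms ij by (auto simp: mod_Suc split: if_splits)
qed

lemma ups_le: assumes "x < r" shows "ups x \<le> g"
proof -
  have "card {i \<in> {..<n}. ver i \<and> row (base i) = x} \<le> card {..<g}"
  proof (rule card_inj_on_le)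
    show "inj_on (\<lambda>i. col (base i)) {i \<in> {..<n}. ver i \<and> row (base i) = x}"
      using base_inj inj base_less by (auto simp: inj_on_def)
    show "(\<lambda>i. col (base i)) ` {i \<in> {..<n}. ver i \<and> row (base i) = x} \<subseteq> {..<g}"
      using col base_less by auto
  qed auto
  then show ?thesis by (simp add: ups_def)
qed

lemma sum_ups: "(\<Sum>x<r. ups x) + hor = n"
proof -
  have "(\<Sum>x<r. ups x) = card (\<Union>x<r. {i \<in> {..<n}. ver i \<and> row (base i) = x})"
    unfolding ups_def by (intro card_UN_disjoint[symmetric]) auto
  also have "\<dots> = card {i \<in> {..<n}. ver i}"
    using row base_less by (intro arg_cong[of _ _ card]) auto
  also have "\<dots> + hor = card ({i \<in> {..<n}. ver i} \<union> {i \<in> {..<n}. \<not> ver i})"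
    unfolding hor_def by (intro card_Un_disjoint[symmetric]) auto
  also have "{i \<in> {..<n}. ver i} \<union> {i \<in> {..<n}. \<not> ver i} = {..<n}" by auto
  finally show ?thesis by simp
qed

text \<open>There are \<open>g\<close> places for an edge of length \<open>a1\<close> above each of
  the \<open>r\<close> rows, in all \<open>n\<close>, which is also the number of edges of the
  tour.\<close>

lemma sum_missing: "(\<Sum>x<r. g - ups x) = hor"
proof -
  have "(\<Sum>x<r. g - ups x) + (\<Sum>x<r. ups x) = (\<Sum>x<r. g)"
    unfolding sum.distrib[symmetric] using ups_le by (intro sum.cong) auto
  then show ?thesis using sum_ups n by (simp only: sum_constant card_lessThan of_nat_id mult.commute)
qed

text \<open>Parity of the crossings of the first rows: with a single step across the seam, the parity
  of the missing vertical edges changes exactly at its two ends.\<close>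

lemma seam_parity:
  assumes "gap (g - 1) = 1"
  obtains p where "p < r"
    "\<And>x. x < r \<Longrightarrow> even (ups x + ups (r - 1)) \<longleftrightarrow> (p \<le> x \<longleftrightarrow> (p + t) mod r \<le> x)"
proof -
  obtain i0 where i0: "{i \<in> {..<n}. \<not> ver i \<and> col (base i) = g - 1} = {i0}"
    using assms unfolding gap_def by (auto simp: card_1_singleton_iff)
  define p where "p = row (base i0)"
  have i0': "i0 < n" "\<not> ver i0" "col (base i0) = g - 1" using i0 by auto
  have uniq: "\<And>i. i < n \<Longrightarrow> \<not> ver i \<Longrightarrow> col (base i) = g - 1 \<Longrightarrow> i = i0" using i0 by blast
  have p: "p < r" unfolding p_def using row base_less i0' by simp
  have "even (ups x + ups (r - 1)) \<longleftrightarrow> (p \<le> x \<longleftrightarrow> (p + t) mod r \<le> x)" if x: "x < r" for x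
  proof (cases "x = r - 1")
    case True
    have "(p + t) mod r < r" using p by (intro mod_less_divisor) simp
    then have "(p + t) mod r \<le> x" "p \<le> x" using True p by linarith+
    then show ?thesis using True by simp
  next
    case False
    then have x': "x < r - 1" using x by simp
    let ?V = "\<lambda>x. {i \<in> {..<n}. ver i \<and> row (base i) = x}"
    \<comment> \<open>The only seam edge joins rows \<open>p\<close> and
      \<open>(p + t) mod r\<close>; it counts when these lie on different sides of the
      boundary.\<close>
    let ?S = "if (p \<le> x) \<noteq> ((p + t) mod r \<le> x) then {i0} else {}"
    define U where "U = (?V x \<union> ?V (r - 1)) \<union> ?S"
    have Un: "U \<subseteq> {..<n}" using i0' by (auto simp: U_def)
    have "{i \<in> {..<n}. (row (base i) \<le> x) \<noteq> (row (other i) \<le> x)} = (?V x \<union> ?V (r - 1)) \<union> ?S"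
    proof -
      have "(row (base i) \<le> x) \<noteq> (row (other i) \<le> x) \<longleftrightarrow> i \<in> (?V x \<union> ?V (r - 1)) \<union> ?S"
        if i: "i < n" for i
      proof (cases "ver i")
        case True
        then show ?thesis
          using prefix_change[OF row[OF base_less[OF i]] x'] i i0' by (auto simp: row_other)
      next
        case nv: False
        show ?thesis
        proof (cases "col (base i) = g - 1")
          case True
          then have "i = i0" using uniq i nv by simp
          then show ?thesis using nv i0' g2 by (simp add: row_other p_def)
        next
          case False
          then have "Suc (col (base i)) < g" using col[OF base_less[OF i]] by simp
          then show ?thesis using nv i False i0' by (auto simp: row_other)
        qed
      qed
      then have "(row (base i) \<le> x) \<noteq> (row (other i) \<le> x) \<longleftrightarrow> i \<in> U" if "i < n" for i
        using that unfolding U_def by blast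
      then show ?thesis using Un unfolding U_def[symmetric] by blast
    qed
    moreover have "card ((?V x \<union> ?V (r - 1)) \<union> ?S) = card (?V x \<union> ?V (r - 1)) + card ?S"
      using i0' by (intro card_Un_disjoint) auto
    moreover have "card (?V x \<union> ?V (r - 1)) = ups x + ups (r - 1)"
      unfolding ups_def using False by (intro card_Un_disjoint) auto
    ultimately have "even (ups x + ups (r - 1) + card ?S)"
      using even_crossings[of "\<lambda>v. row v \<le> x"] by simp
    then show ?thesis by (auto split: if_splits)
  qed
  then show thesis using p that by blast
qed

lemma card_between:
  fixes p q :: nat
  assumes "p < r" "q < r"
  shows "card {x \<in> {..<r}. (p \<le> x) \<noteq> (q \<le> x)} = (if p \<le> q then q - p else p - q)"
proof -
  have "{x \<in> {..<r}. (p \<le> x) \<noteq> (q \<le> x)} = (if p \<le> q then {p..<q} else {q..<p})"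
    using assms by auto
  then show ?thesis by simp
qed

lemma single_seam_bound:
  assumes "gap (g - 1) = 1"
  shows "\<exists>A \<in> {t, r - t}. A \<le> hor \<and> even (A + hor)"
proof -
  obtain p where p: "p < r" and par:
    "\<And>x. x < r \<Longrightarrow> even (ups x + ups (r - 1)) \<longleftrightarrow> (p \<le> x \<longleftrightarrow> (p + t) mod r \<le> x)"
    using seam_parity[OF assms] by blast
  define q where "q = (p + t) mod r"
  define D where "D = {x \<in> {..<r}. (p \<le> x) \<noteq> (q \<le> x)}"
  have q: "q < r" unfolding q_def using p by (intro mod_less_divisor) simp
  have "card D = (if p \<le> q then q - p else p - q)"
    unfolding D_def using p q by (rule card_between)
  moreover have "q = (if p + t < r then p + t else p + t - r)"
    using p t by (simp add: q_def mod_if)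
  ultimately have cD: "card D = t \<or> card D = r - t" using p t by (auto split: if_splits)
  have Dsub: "D \<subseteq> {..<r}" by (auto simp: D_def)
  \<comment> \<open>The rows above which an odd number of edges is missing. Relative to row
    \<open>r - 1\<close> the parity differs exactly on \<open>D\<close>, so this set is
    \<open>D\<close> or its complement. Each of its rows accounts for at least one missing edge, and
    the remaining missing edges are even in number.\<close>
  define O' where "O' = {x \<in> {..<r}. odd (g - ups x)}"
  have "O' = D \<or> O' = {..<r} - D"
  proof (cases "even (g - ups (r - 1))")
    case True
    have "odd (g - ups x) \<longleftrightarrow> x \<in> D" if "x < r" for x
      using par[OF that] True ups_le[OF that] ups_le[of "r - 1"] that p
      by (auto simp: D_def q_def)
    then show ?thesis unfolding O'_def using Dsub by auto
  next
    case False
    have "odd (g - ups x) \<longleftrightarrow> x \<notin> D" if "x < r" for x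
      using par[OF that] False ups_le[OF that] ups_le[of "r - 1"] that p
      by (auto simp: D_def q_def)
    then show ?thesis unfolding O'_def using Dsub by auto
  qed
  then have "card O' = card D \<or> card O' = r - card D"
    using Dsub by (auto simp: card_Diff_subset finite_subset)
  then have A: "card O' \<in> {t, r - t}" using cD t by auto
  have "card O' = (\<Sum>x<r. if odd (g - ups x) then 1 else 0)"
    unfolding O'_def by (intro card_inter_sum) simp
  moreover have "\<dots> \<le> (\<Sum>x<r. g - ups x)"
  proof (rule sum_mono)
    fix x
    show "(if odd (g - ups x) then 1 else 0) \<le> g - ups x" by (cases "g - ups x") auto
  qed
  moreover have "even ((\<Sum>x<r. if odd (g - ups x) then 1 else 0) + (\<Sum>x<r. g - ups x))"
    unfolding sum.distrib[symmetric] by (intro dvd_sum) auto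
  ultimately show ?thesis using A sum_missing by (intro bexI[of _ "card O'"]) auto
qed

end

section \<open>Coordinates of the residues\<close>

locale stripes =
  fixes n a1 a2 g r :: nat
  assumes inst: "two_stripe_instance n a1 a2"
    and g_def: "g = gcd n a1" and r_def: "r = n div g"
begin

lemma n_eq: "n = g * r" by (simp add: g_def r_def)

lemma a1_bounds: "1 \<le> a1" "2 * a1 \<le> n" and a2_bounds: "1 \<le> a2" "2 * a2 \<le> n"
  using inst by (auto simp: two_stripe_instance_def)

lemma g2: "2 \<le> g"
  using inst by (simp add: two_stripe_instance_def g_def)

lemma r2: "2 \<le> r"
proof -
  have "g \<le> a1" unfolding g_def using a1_bounds by (intro dvd_imp_le) auto
  then have "2 * g \<le> r * g" using a1_bounds n_eq mult.commute[of g r] by linarith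
  then show ?thesis using g2 by simp
qed

lemma n4: "4 \<le> n"
  using mult_le_mono[OF g2 r2] unfolding n_eq by simp

lemma coprime_g_a2: "coprime g a2"
  using inst by (simp add: two_stripe_instance_def g_def coprime_iff_gcd_eq_1)

lemma g_dvd_a1: "g dvd a1" by (simp add: g_def)

text \<open>The order of \<open>a1\<close> modulo \<open>n\<close> is \<open>r\<close>: after
  division by \<open>g\<close> the step becomes coprime to \<open>r\<close>.\<close>

lemma dvd_r_iff: "n dvd x * a1 \<longleftrightarrow> r dvd x"
proof -
  obtain b where b: "a1 = g * b" using g_dvd_a1 by blast
  have "g * gcd r b = gcd (g * r) (g * b)" by (rule gcd_mult_distrib_nat)
  also have "\<dots> = g" by (simp only: n_eq[symmetric] b[symmetric] g_def[symmetric])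
  finally have "g * gcd r b = g" .
  then have "coprime r b" using g2 by (simp add: coprime_iff_gcd_eq_1)
  then have "r dvd x * b \<longleftrightarrow> r dvd x" by (simp add: coprime_dvd_mult_left_iff)
  moreover have "n dvd x * a1 \<longleftrightarrow> g * r dvd g * (x * b)"
    by (subst n_eq, subst b) (simp only: mult_ac)
  ultimately show ?thesis using g2 by simp
qed

lemma cong_a1_iff: "[x * a1 = y * a1] (mod n) \<longleftrightarrow> [x = y] (mod r)"
proof -
  have *: "[x * a1 = y * a1] (mod n) \<longleftrightarrow> [x = y] (mod r)" if "y \<le> x" for x y
    using that dvd_r_iff[of "x - y"]
    by (simp add: cong_altdef_nat diff_mult_distrib)
  show ?thesis
    by (cases "y \<le> x") (use *[of y x] *[of x y] cong_sym_eq in auto)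
qed

definition vertex :: "nat \<Rightarrow> nat \<Rightarrow> nat" where
  "vertex k x = (k * a2 + x * a1) mod n"

lemma vertex_less: "vertex k x < n" using n4 by (simp add: vertex_def)

text \<open>Modulo \<open>g\<close> the multiples of \<open>a1\<close> vanish and \<open>a2\<close>
  is invertible, which determines the column; cancelling it leaves the row modulo the order of
  \<open>a1\<close>.\<close>

lemma vertex_inj:
  assumes "vertex k x = vertex l y" "k < g" "l < g"
  shows "k = l \<and> [x = y] (mod r)"
proof -
  have c: "[k * a2 + x * a1 = l * a2 + y * a1] (mod n)"
    using assms(1) by (simp add: vertex_def cong_def)
  have z: "[z * a1 = 0] (mod g)" for z using g_dvd_a1 by (simp add: cong_0_iff)
  have "[k * a2 + 0 = k * a2 + x * a1] (mod g)" "[l * a2 + y * a1 = l * a2 + 0] (mod g)"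
    by (rule cong_add[OF cong_refl cong_sym[OF z]], rule cong_add[OF cong_refl z])
  moreover have "[k * a2 + x * a1 = l * a2 + y * a1] (mod g)"
    using c by (rule cong_dvd_modulus_nat) (simp add: g_def)
  ultimately have "[k * a2 = l * a2] (mod g)" by (metis add_0_right cong_trans)
  then have "[k = l] (mod g)"
    using coprime_g_a2 by (simp add: cong_mult_rcancel_nat coprime_commute)
  then have "k = l" using assms by (simp add: cong_def)
  then show ?thesis using c cong_a1_iff cong_add_lcancel_nat by blast
qed

lemma vertex_bij: "bij_betw (\<lambda>(k, x). vertex k x) ({..<g} \<times> {..<r}) {..<n}"
proof -
  have inj: "inj_on (\<lambda>(k, x). vertex k x) ({..<g} \<times> {..<r})"
    using vertex_inj by (fastforce simp: inj_on_def cong_def)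
  moreover have "(\<lambda>(k, x). vertex k x) ` ({..<g} \<times> {..<r}) = {..<n}"
    using vertex_less card_image[OF inj] n_eq
    by (intro card_subset_eq) (auto simp: card_cartesian_product)
  ultimately show ?thesis by (simp add: bij_betw_def)
qed

definition coords :: "nat \<Rightarrow> nat \<times> nat" where
  "coords = the_inv_into ({..<g} \<times> {..<r}) (\<lambda>(k, x). vertex k x)"

lemma coords_vertex: "k < g \<Longrightarrow> x < r \<Longrightarrow> coords (vertex k x) = (k, x)"
  using the_inv_into_f_f[OF bij_betw_imp_inj_on[OF vertex_bij], of "(k, x)"]
  by (simp add: coords_def)

lemma obtain_coords:
  assumes "v < n"
  obtains k x where "k < g" "x < r" "v = vertex k x" "coords v = (k, x)"
proof -
  have "v \<in> (\<lambda>(k, x). vertex k x) ` ({..<g} \<times> {..<r})"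
    using vertex_bij assms by (simp add: bij_betw_def)
  then show thesis using that coords_vertex by auto
qed

lemma coords_less: "v < n \<Longrightarrow> fst (coords v) < g \<and> snd (coords v) < r"
  by (erule obtain_coords) simp

lemma vertex_mod_r: "vertex k (x mod r) = vertex k x"
  using cong_a1_iff[of "x mod r" x] cong_add_lcancel_nat[of "k * a2" "x mod r * a1" "x * a1" n]
  by (simp add: vertex_def cong_def)

lemma vertex_add_a1: "(vertex k x + a1) mod n = vertex k (Suc x)"
  unfolding vertex_def mod_add_left_eq by (simp add: algebra_simps)

lemma vertex_add_a2: "(vertex k x + a2) mod n = vertex (Suc k) x"
  unfolding vertex_def mod_add_left_eq by (simp add: algebra_simps)

end

locale stripes_shift = stripes +
  fixes t :: nat
  assumes t: "t < r" "[g * a2 = t * a1] (mod n)"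
begin

lemma vertex_g: "vertex (k + g) x = vertex k (x + t)"
proof -
  have "[k * a2 + x * a1 + g * a2 = k * a2 + x * a1 + t * a1] (mod n)"
    using t by (simp add: cong_add_lcancel_nat)
  then show ?thesis by (simp add: vertex_def cong_def algebra_simps)
qed

lemma torus_coords: "torus n a1 a2 g r t (\<lambda>v. fst (coords v)) (\<lambda>v. snd (coords v))"
proof (unfold_locales, goal_cases)
  case (7 v w)
  obtain k x where "v = vertex k x" "coords v = (k, x)" using obtain_coords[OF 7(1)] by blast
  moreover obtain l y where "w = vertex l y" "coords w = (l, y)" using obtain_coords[OF 7(2)] by blast
  ultimately show ?case using 7(3,4) by simp
next
  case (8 i x)
  then show ?case using coords_vertex vertex_less by (intro exI[of _ "vertex i x"]) simp
next
  case (9 v)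
  then obtain k x where v: "k < g" "x < r" "v = vertex k x" "coords v = (k, x)" by (rule obtain_coords)
  then have "(v + a1) mod n = vertex k (Suc x mod r)"
    by (simp add: vertex_add_a1 vertex_mod_r)
  then show ?case using v coords_vertex by simp
next
  case (10 v)
  then obtain k x where v: "k < g" "x < r" "v = vertex k x" "coords v = (k, x)" by (rule obtain_coords)
  then have "(v + a1) mod n = vertex k (Suc x mod r)"
    by (simp add: vertex_add_a1 vertex_mod_r)
  then show ?case using v coords_vertex by simp
next
  case (11 v)
  then obtain k x where v: "k < g" "x < r" "v = vertex k x" "coords v = (k, x)" by (rule obtain_coords)
  show ?case
  proof (cases "Suc k < g")
    case True
    then show ?thesis using v coords_vertex by (simp add: vertex_add_a2)
  next
    case False
    then have kg: "Suc k = g" using v by simp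
    then have "(v + a2) mod n = vertex 0 ((x + t) mod r)"
      using v vertex_g[of 0 x] by (simp add: vertex_add_a2 vertex_mod_r)
    then show ?thesis using v kg coords_vertex[of 0 "(x + t) mod r"] r2 by simp
  qed
next
  case (12 v)
  then obtain k x where v: "k < g" "x < r" "v = vertex k x" "coords v = (k, x)" by (rule obtain_coords)
  show ?case
  proof (cases "Suc k < g")
    case True
    then show ?thesis using v coords_vertex by (simp add: vertex_add_a2)
  next
    case False
    then have kg: "Suc k = g" using v by simp
    then have "(v + a2) mod n = vertex 0 ((x + t) mod r)"
      using v vertex_g[of 0 x] by (simp add: vertex_add_a2 vertex_mod_r)
    then show ?thesis using v kg coords_vertex[of 0 "(x + t) mod r"] r2 by simp
  qed
qed (fact n_eq g2 r2 t(1) | simp add: coords_less)+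

end

text \<open>A translation of the coordinates moves the seam to any gap between columns.\<close>

lemma (in torus) translate:
  "torus n a1 a2 g r t (\<lambda>v. col ((v + c) mod n)) (\<lambda>v. row ((v + c) mod n))"
proof -
  have lt: "(v + c) mod n < n" for v using n4 by simp
  have comm: "((v + a) mod n + c) mod n = ((v + c) mod n + a) mod n" for v a
    unfolding mod_add_left_eq by (simp add: add_ac)
  show ?thesis
  proof (unfold_locales, goal_cases)
    case (7 v w)
    then have "(v + c) mod n = (w + c) mod n" using inj lt by blast
    then show ?case using 7 cong_add_rcancel_nat[of v c w n] by (simp add: cong_def)
  next
    case (8 i x)
    then obtain w where w: "w < n" "col w = i" "row w = x" using surj by blast
    define v where "v = (w + (n - c mod n)) mod n"
    have "(v + c) mod n = (w + (n - c mod n) + c mod n) mod n"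
      unfolding v_def by (simp add: mod_add_left_eq mod_add_right_eq)
    also have "w + (n - c mod n) + c mod n = w + n"
      using mod_less_divisor[of n c] n4 by linarith
    also have "(w + n) mod n = w" using w by simp
    finally show ?case using w n4 by (intro exI[of _ v]) (simp add: v_def)
  qed (use n g2 r2 t col row lt col_a1 row_a1 col_a2 row_a2 comm in simp_all)
qed

lemma (in torus) col_add: "v < n \<Longrightarrow> col ((v + j * a2) mod n) = (col v + j) mod g"
proof (induction j)
  case (Suc j)
  have "(v + Suc j * a2) mod n = ((v + j * a2) mod n + a2) mod n"
    unfolding mod_add_left_eq by (simp add: algebra_simps)
  then show ?case using Suc col_a2[of "(v + j * a2) mod n"] n4 by (simp add: mod_Suc_eq)
qed (use col in simp)

context finite_tour
begin

lemma hor_bound: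
  shows "2 * (g - 1) \<le> hor \<or> g \<le> hor \<and> (\<exists>A \<in> {t, r - t}. A \<le> hor \<and> even (A + g))"
proof (cases "even (gap (g - 1)) \<or> 2 * (g - 1) \<le> hor")
  case True
  then show ?thesis using even_gaps_bound by blast
next
  case False
  then have od: "odd (gap (g - 1))" and lt: "hor < 2 * (g - 1)" by auto
  then have "hor < 3 * g" by linarith
  then obtain k where k: "k < g" "gap k = 1" using odd_gaps(3)[OF od] by blast
  \<comment> \<open>Moves column \<open>k\<close> to the last place, so that its gap becomes the
    seam.\<close>
  define c where "c = (g - 1 - k) * a2"
  interpret T: torus n a1 a2 g r t "\<lambda>v. col ((v + c) mod n)" "\<lambda>v. row ((v + c) mod n)"
    by (rule translate)
  interpret T: finite_tour n a1 a2 g r t "\<lambda>v. col ((v + c) mod n)" "\<lambda>v. row ((v + c) mod n)" ys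
    by unfold_locales (use len tour fin in auto)
  have "col ((v + c) mod n) = g - 1 \<longleftrightarrow> col v = k" if "v < n" for v
  proof -
    have "col ((v + c) mod n) = (col v + (g - 1 - k)) mod g"
      using col_add[OF that] by (simp add: c_def)
    moreover have "col v < g" using col that by simp
    ultimately show ?thesis using k by (auto simp: mod_if)
  qed
  \<comment> \<open>\<open>base\<close> and \<open>hor\<close> do not involve the coordinates; only
    the numbering of the gaps changes.\<close>
  then have "T.gap (g - 1) = gap k"
    unfolding T.gap_def gap_def using base_less by (intro arg_cong[of _ _ card]) auto
  then have "T.gap (g - 1) = 1" using k by simp
  then obtain A where A: "A \<in> {t, r - t}" "A \<le> hor" "even (A + hor)"
    using T.single_seam_bound by blast
  from A(3) odd_gaps(2)[OF od] have "even (A + g)" by (simp only: even_add)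
  with A have "\<exists>A \<in> {t, r - t}. A \<le> hor \<and> even (A + g)" by (intro bexI[of _ A] conjI)
  with odd_gaps(1)[OF od] show ?thesis by (intro disjI2 conjI)
qed

end

lemma sum_indicator_enat:
  "finite A \<Longrightarrow> (\<Sum>i\<in>A. if P i then 1 else 0 :: enat) = enat (card {i \<in> A. P i})"
  by (simp add: sum.If_cases Int_def of_nat_eq_enat)

theorem (in stripes_shift) tour_cost_bound:
  assumes "is_tour n ys"
  shows "enat (2 * (g - 1)) \<le> tour_cost n a1 a2 ys \<or>
    (\<exists>A \<in> {t, r - t}. even (A + g) \<and> enat (max g A) \<le> tour_cost n a1 a2 ys)"
proof (cases "\<forall>i<n. stripe_edge n a1 (ys ! i) (ys ! (Suc i mod n)) \<or>
    stripe_edge n a2 (ys ! i) (ys ! (Suc i mod n))")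
  case True
  interpret torus n a1 a2 g r t "\<lambda>v. fst (coords v)" "\<lambda>v. snd (coords v)"
    by (rule torus_coords)
  have "length ys = n" using assms distinct_card[of ys] by (simp add: is_tour_def)
  then interpret finite_tour n a1 a2 g r t "\<lambda>v. fst (coords v)" "\<lambda>v. snd (coords v)" ys
    by unfold_locales (use assms True in \<open>auto simp: is_tour_def\<close>)
  have "tour_cost n a1 a2 ys = (\<Sum>i<n. if \<not> ver i then 1 else 0)"
    unfolding tour_cost_def
    by (intro sum.cong) (use True in \<open>auto simp: edge_cost_def ver_def cur_def nxt_def\<close>)
  also have "\<dots> = enat hor" unfolding hor_def by (rule sum_indicator_enat) simp
  finally show ?thesis using hor_bound by auto
next
  case False
  then obtain i where i: "i < n" "edge_cost n a1 a2 (ys ! i) (ys ! (Suc i mod n)) = \<infinity>"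
    by (auto simp: edge_cost_def)
  have "edge_cost n a1 a2 (ys ! i) (ys ! (Suc i mod n)) \<le> tour_cost n a1 a2 ys"
    unfolding tour_cost_def using i
    by (intro member_le_sum[where f = "\<lambda>i. edge_cost n a1 a2 (ys ! i) (ys ! (Suc i mod n))"]) auto
  then show ?thesis using i by simp
qed

section \<open>Two classes of tours\<close>

lemma stripe_edge_commute: "stripe_edge n a u v \<longleftrightarrow> stripe_edge n a v u"
  by (auto simp: stripe_edge_def)

lemma cong_multipleI: "x = y + q * r \<Longrightarrow> [x = y] (mod (r::nat))"
  by (simp add: cong_def)

text \<open>The step \<open>b\<close> is \<open>a1\<close> or its negative modulo \<open>n\<close>.
  Reversing the rows exchanges the shifts \<open>t\<close> and \<open>r - t\<close>, so one
  construction of tours serves both.\<close>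

locale directed_stripes = stripes +
  fixes b :: nat
  assumes b: "b = a1 \<or> b = n - a1"
begin

definition vert :: "nat \<Rightarrow> nat \<Rightarrow> nat" where
  "vert k x = (k * a2 + x * b) mod n"

lemma r_b: "n dvd r * b"
proof -
  have "n dvd r * a1" using dvd_r_iff by simp
  moreover have "n dvd r * n - r * a1" using calculation by (intro dvd_diff_nat) auto
  ultimately show ?thesis using b by (auto simp: diff_mult_distrib2)
qed

lemma vert_cong: assumes "[x = y] (mod r)" shows "vert k x = vert k y"
proof -
  have *: "vert k x = vert k y" if "x = y + q * r" for x y q
  proof -
    have "(k * a2 + (y + q * r) * b) mod n = (k * a2 + y * b + q * (r * b)) mod n"
      by (simp add: algebra_simps)
    also have "\<dots> = (k * a2 + y * b) mod n"
      using r_b by (metis mod_add_self2 add.right_neutral dvd_imp_mod_0 mod_add_right_eq mod_mult_right_eq mult_0_right)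
    finally show ?thesis by (simp only: that vert_def)
  qed
  have "vert k x = vert k (x mod r)" "vert k y = vert k (y mod r)"
    using *[of x "x mod r" "x div r"] *[of y "y mod r" "y div r"] by simp_all
  then show ?thesis using assms by (simp add: cong_def)
qed

lemma vert_Suc_edge: "stripe_edge n a1 (vert k x) (vert k (Suc x))"
  using b
proof
  assume "b = a1"
  then show ?thesis unfolding stripe_edge_def vert_def mod_add_left_eq by (simp add: algebra_simps)
next
  assume b: "b = n - a1"
  have "(vert k (Suc x) + a1) mod n = (k * a2 + x * b + (b + a1)) mod n"
    unfolding vert_def mod_add_left_eq by (simp add: algebra_simps)
  also have "b + a1 = n" using b a1_bounds by simp
  also have "(k * a2 + x * b + n) mod n = vert k x" by (simp add: vert_def)
  finally show ?thesis by (simp add: stripe_edge_def)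
qed

lemma vert_edge:
  assumes "[y = Suc x] (mod r) \<or> [x = Suc y] (mod r)"
  shows "stripe_edge n a1 (vert k x) (vert k y)"
  using assms vert_Suc_edge[of k x] vert_Suc_edge[of k y] vert_cong[of y "Suc x" k]
    vert_cong[of x "Suc y" k] stripe_edge_commute by auto

lemma hor_edge:
  assumes "[y = x] (mod r)"
  shows "stripe_edge n a2 (vert k x) (vert (Suc k) y)"
proof -
  have "(vert k x + a2) mod n = vert (Suc k) x"
    unfolding vert_def mod_add_left_eq by (simp add: algebra_simps)
  then show ?thesis using vert_cong[OF assms, of "Suc k"] by (simp add: stripe_edge_def)
qed

lemma seam_edge:
  assumes "[g * a2 = A * b] (mod n)" "[y = x + A] (mod r)"
  shows "stripe_edge n a2 (vert (g - 1) x) (vert 0 y)"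
proof -
  have "Suc (g - 1) = g" using g2 by simp
  then have "vert (Suc (g - 1)) x = vert 0 (x + A)"
    using cong_add_rcancel_nat[of "g * a2" "x * b" "A * b" n] assms(1)
    by (simp add: vert_def cong_def algebra_simps)
  then show ?thesis using hor_edge[of x x "g - 1"] vert_cong[OF assms(2), of 0] by simp
qed

lemma vert_surj:
  assumes "v < n"
  obtains k x where "k < g" "x < r" "v = vert k x"
proof -
  obtain k x where v: "k < g" "x < r" "v = vertex k x" using obtain_coords[OF assms] by blast
  from b show thesis
  proof
    assume "b = a1"
    then have "vertex k x = vert k x" unfolding vert_def vertex_def by simp
    then show thesis using v that by simp
  next
    assume b: "b = n - a1"
    \<comment> \<open>Row \<open>x\<close> in one direction is row \<open>r - x\<close> in the
      other.\<close>
    have "[(r - x) * b + (r - x) * a1 = x * a1 + (r - x) * a1] (mod n)"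
    proof -
      have "(r - x) * b + (r - x) * a1 = (r - x) * n"
        using b a1_bounds by (simp add: add_mult_distrib2[symmetric])
      moreover have "x * a1 + (r - x) * a1 = r * a1"
        using v by (simp add: add_mult_distrib[symmetric])
      moreover have "n dvd r * a1" using dvd_r_iff by simp
      ultimately show ?thesis by (simp add: cong_def)
    qed
    then have "[k * a2 + (r - x) * b = k * a2 + x * a1] (mod n)"
      by (simp add: cong_add_rcancel_nat cong_add_lcancel_nat)
    then have "v = vert k (r - x)" using v by (simp add: vert_def vertex_def cong_def)
    also have "\<dots> = vert k ((r - x) mod r)" by (intro vert_cong) (simp add: cong_def)
    finally show thesis using v r2 that[of k "(r - x) mod r"] by simp
  qed
qed

definition walk :: "(nat \<Rightarrow> nat) \<Rightarrow> (nat \<Rightarrow> nat) \<Rightarrow> nat list" where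
  "walk C R = map (\<lambda>i. vert (C i) (R i)) [0..<n]"

text \<open>\<open>H\<close> holds the positions followed by an edge of length \<open>a2\<close>.
  Coverage suffices for a tour: a list of length \<open>n\<close> that hits all \<open>n\<close>
  vertices cannot repeat one.\<close>

lemma walk_tour:
  assumes cover: "\<And>k x. k < g \<Longrightarrow> x < r \<Longrightarrow> \<exists>i<n. C i = k \<and> [R i = x] (mod r)"
    and v: "\<And>i. i < n \<Longrightarrow> i \<notin> H \<Longrightarrow> C (Suc i mod n) = C i \<and>
      ([R (Suc i mod n) = Suc (R i)] (mod r) \<or> [R i = Suc (R (Suc i mod n))] (mod r))"
    and h: "\<And>i. i < n \<Longrightarrow> i \<in> H \<Longrightarrow>
      stripe_edge n a2 (vert (C i) (R i)) (vert (C (Suc i mod n)) (R (Suc i mod n)))"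
    and H: "finite H" "card H \<le> c"
  shows "is_tour n (walk C R)" "tour_cost n a1 a2 (walk C R) \<le> enat c"
proof -
  have "\<exists>i<n. vert (C i) (R i) = v" if "v < n" for v
    using vert_surj[OF that] cover vert_cong by metis
  then have set: "set (walk C R) = {..<n}"
    using n4 by (fastforce simp: walk_def vert_def)
  moreover have "distinct (walk C R)"
    using set by (intro card_distinct) (simp add: walk_def)
  ultimately show "is_tour n (walk C R)" by (simp add: is_tour_def)
  have nth: "walk C R ! i = vert (C i) (R i)" if "i < n" for i
    using that by (simp add: walk_def)
  have "tour_cost n a1 a2 (walk C R) \<le> (\<Sum>i<n. if i \<in> H then 1 else 0)"
    unfolding tour_cost_def
  proof (rule sum_mono)
    fix i assume "i \<in> {..<n}"
    then have i: "i < n" "Suc i mod n < n" by auto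
    show "edge_cost n a1 a2 (walk C R ! i) (walk C R ! (Suc i mod n)) \<le> (if i \<in> H then 1 else 0)"
      using v[OF i(1)] h[OF i(1)] vert_edge nth[OF i(1)] nth[OF i(2)]
      by (auto simp: edge_cost_def)
  qed
  also have "\<dots> = enat (card {i \<in> {..<n}. i \<in> H})" by (rule sum_indicator_enat) simp
  also have "card {i \<in> {..<n}. i \<in> H} \<le> card H" using H by (intro card_mono) auto
  finally show "tour_cost n a1 a2 (walk C R) \<le> enat c" using H
    by (metis enat_ord_simps(1) le_trans order.trans)
qed

end

text \<open>Along the first row, and back through the columns.\<close>

definition comb_col :: "nat \<Rightarrow> nat \<Rightarrow> nat \<Rightarrow> nat" where
  "comb_col g r i = (if i < g then i else g - 1 - (i - g) div (r - 1))"

definition comb_row :: "nat \<Rightarrow> nat \<Rightarrow> nat \<Rightarrow> nat" where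
  "comb_row g r i = (if i < g then 0
     else if even ((i - g) div (r - 1)) then 1 + (i - g) mod (r - 1)
     else r - 1 - (i - g) mod (r - 1))"

text \<open>Block \<open>k\<close> of the way back runs through column \<open>g - 1 - k\<close>
  without row 0, hence the length \<open>r - 1\<close>. The direction alternates, so that
  consecutive blocks meet in the same row.\<close>

lemma comb_later:
  assumes "k < g" "j < r - 1"
  shows "comb_col g r (g + k * (r - 1) + j) = g - 1 - k"
    "comb_row g r (g + k * (r - 1) + j) = (if even k then 1 + j else r - 1 - j)"
proof -
  have "(g + k * (r - 1) + j - g) div (r - 1) = k" "(g + k * (r - 1) + j - g) mod (r - 1) = j"
    using assms by (simp_all add: add.assoc)
  then show "comb_col g r (g + k * (r - 1) + j) = g - 1 - k"
    "comb_row g r (g + k * (r - 1) + j) = (if even k then 1 + j else r - 1 - j)"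
    by (simp_all add: comb_col_def comb_row_def)
qed

lemma (in directed_stripes) comb_tour:
  defines "xs \<equiv> walk (comb_col g r) (comb_row g r)"
  shows "is_tour n xs" "tour_cost n a1 a2 xs \<le> enat (2 * (g - 1))"
proof -
  \<comment> \<open>The steps along row 0 and the changes of column on the way back,
    \<open>g - 1\<close> of each kind.\<close>
  define H where "H = {..<g - 1} \<union> (\<lambda>k. g + k * (r - 1) - 1) ` {1..<g}"
  have nn: "n = g + g * (r - 1)" using n_eq r2 by (cases r) simp_all
  have pos: "g + k * (r - 1) + j < n" if "k < g" "j < r - 1" for k j
  proof -
    have "Suc k * (r - 1) \<le> g * (r - 1)" using that by (intro mult_le_mono1) simp
    then show ?thesis using that nn by simp
  qed
  have split: "\<exists>k j. k < g \<and> j < r - 1 \<and> i = g + k * (r - 1) + j" if "g \<le> i" "i < n" for i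
  proof -
    have "i - g < g * (r - 1)" using that nn by simp
    then have "(i - g) div (r - 1) < g" using r2 by (simp add: less_mult_imp_div_less)
    moreover have "i = g + (i - g) div (r - 1) * (r - 1) + (i - g) mod (r - 1)"
      using that div_mult_mod_eq[of "i - g" "r - 1"] by linarith
    moreover have "(i - g) mod (r - 1) < r - 1" using r2 by simp
    ultimately show ?thesis by blast
  qed
  have cover: "\<exists>i<n. comb_col g r i = k \<and> [comb_row g r i = x] (mod r)" if "k < g" "x < r" for k x
  proof (cases "x = 0")
    case True
    then show ?thesis using that nn by (intro exI[of _ k]) (simp add: comb_col_def comb_row_def)
  next
    case False
    define j where "j = (if even (g - 1 - k) then x - 1 else r - 1 - x)"
    have "g - 1 - k < g" "j < r - 1" using that False by (auto simp: j_def)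
    from comb_later[OF this] pos[OF this] show ?thesis
      using that False by (intro exI[of _ "g + (g - 1 - k) * (r - 1) + j"]) (auto simp: j_def)
  qed
  have vh: "(i \<notin> H \<longrightarrow> comb_col g r (Suc i mod n) = comb_col g r i \<and>
      ([comb_row g r (Suc i mod n) = Suc (comb_row g r i)] (mod r) \<or>
       [comb_row g r i = Suc (comb_row g r (Suc i mod n))] (mod r))) \<and>
     (i \<in> H \<longrightarrow> stripe_edge n a2 (vert (comb_col g r i) (comb_row g r i))
        (vert (comb_col g r (Suc i mod n)) (comb_row g r (Suc i mod n))))"
    if i: "i < n" for i
  proof -
    consider "i < g - 1" | "i = g - 1" | "g \<le> i" by linarith
    then show ?thesis
    proof cases
      case 1
      then have "i \<in> H" "Suc i mod n = Suc i" using nn by (auto simp: H_def)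
      moreover have "i < g" "Suc i < g" using 1 by simp_all
      ultimately show ?thesis using hor_edge[of 0 0 i] by (simp add: comb_col_def comb_row_def)
    next
      case 2
      have "i \<notin> H"
      proof
        assume "i \<in> H"
        then obtain k where "1 \<le> k" "i = g + k * (r - 1) - 1" using 2 by (auto simp: H_def)
        moreover have "1 * 1 \<le> k * (r - 1)" using r2 \<open>1 \<le> k\<close> by (intro mult_le_mono) auto
        ultimately show False using 2 g2 by linarith
      qed
      moreover have "Suc i mod n = g + 0 * (r - 1) + 0" using 2 g2 r2 nn by simp
      ultimately show ?thesis using 2 g2 r2 comb_later[of 0 g 0 r]
        by (simp add: comb_col_def comb_row_def)
    next
      case 3
      then obtain k j where kj: "k < g" "j < r - 1" "i = g + k * (r - 1) + j"
        using split i by blast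
      note here = comb_later[OF kj(1,2), folded kj(3)]
      show ?thesis
      proof (cases "Suc j < r - 1")
        case True
        then have nxt: "Suc i = g + k * (r - 1) + Suc j" "Suc i < n"
          using kj pos[of k "Suc j"] by simp_all
        have "i \<notin> H"
        proof
          assume "i \<in> H"
          then obtain l where "1 \<le> l" "Suc i = g + l * (r - 1)" using 3 g2 by (force simp: H_def)
          then have "(k * (r - 1) + Suc j) mod (r - 1) = (l * (r - 1)) mod (r - 1)"
            using nxt by simp
          then show False using True by simp
        qed
        moreover have "comb_col g r (Suc i) = comb_col g r i"
          "comb_row g r (Suc i) = Suc (comb_row g r i) \<or> comb_row g r i = Suc (comb_row g r (Suc i))"
          using here comb_later[OF kj(1) True, folded nxt(1)] True by simp_all linarith+
        ultimately show ?thesis using nxt(2) by auto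
      next
        case False
        then have j: "j = r - 2" using kj by simp
        then have nxt: "Suc i = g + Suc k * (r - 1)" using kj r2 by simp
        show ?thesis
        proof (cases "Suc k < g")
          case True
          have "i = g + Suc k * (r - 1) - 1" using nxt by simp
          then have "i \<in> H" using True unfolding H_def by (intro UnI2 image_eqI[of _ _ "Suc k"]) auto
          moreover have "Suc i < n" using nxt pos[OF True, of 0] r2 by simp
          moreover have nh: "comb_col g r (Suc i) = g - 1 - Suc k"
            "comb_row g r (Suc i) = (if even (Suc k) then 1 else r - 1)"
            using comb_later[OF True, of 0 r] nxt r2 by simp_all
          moreover have "comb_col g r i = Suc (g - 1 - Suc k)" using here True by simp
          moreover have "comb_row g r i = comb_row g r (Suc i)"
            using here nh j r2 by auto
          ultimately show ?thesis
            using hor_edge[of "comb_row g r i" "comb_row g r i" "g - 1 - Suc k"] stripe_edge_commute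
            by simp
        next
          case False
          \<comment> \<open>The end of column 0 is in row \<open>r - 1\<close> or 1 according to the
            direction. Both are next to row 0, so the closing edge has length \<open>a1\<close> for
            either parity of \<open>g\<close>.\<close>
          then have k: "Suc k = g" using kj by simp
          then have "Suc i = n" using nxt nn by simp
          moreover have "i \<notin> H"
          proof
            assume "i \<in> H"
            then obtain l where "l < g" "Suc i = g + l * (r - 1)" using 3 g2 by (force simp: H_def)
            then show False using nxt k r2 by simp
          qed
          moreover have "comb_col g r i = 0" using here k by simp
          moreover have "[comb_row g r 0 = Suc (comb_row g r i)] (mod r) \<or>
              [comb_row g r i = Suc (comb_row g r 0)] (mod r)"
          proof -
            have "comb_row g r i = (if even k then r - 1 else 1)" "comb_row g r 0 = 0" "Suc (r - 1) = r"
              using here(2) j r2 g2 by (auto simp: comb_row_def[of g r 0])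
            then show ?thesis by (cases "even k") (simp_all add: cong_def)
          qed
          ultimately show ?thesis using g2 by (simp add: comb_col_def)
        qed
      qed
    qed
  qed
  have "card H \<le> card {..<g - 1} + card ((\<lambda>k. g + k * (r - 1) - 1) ` {1..<g})"
    unfolding H_def by (rule card_Un_le)
  also have "\<dots> \<le> card {..<g - 1} + card {1..<g}"
    by (intro add_left_mono card_image_le) simp
  finally have cH: "card H \<le> 2 * (g - 1)" by simp
  have "finite H" by (simp add: H_def)
  from walk_tour[of "comb_col g r" "comb_row g r" H, OF cover _ _ this cH]
  show "is_tour n xs" "tour_cost n a1 a2 xs \<le> enat (2 * (g - 1))"
    using vh unfolding xs_def by blast+
qed

text \<open>The first two columns are traversed together, with \<open>2 * m + 1\<close> crossings between them;
  the end of this part is \<open>2 * m + 2\<close> rows below its start. Of the other columns, which are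
  traversed one after the other, those before column \<open>u\<close> decrease the row by 1 and the other ones
  increase it by 1.\<close>

definition zigzag_col :: "nat \<Rightarrow> nat \<Rightarrow> nat \<Rightarrow> nat" where
  "zigzag_col r m i =
    (if i < r - 2 * m then 0
     else if i < r + 2 * m then (if (i - (r - 2 * m)) mod 4 < 2 then 1 else 0)
     else if i < 2 * r then 1 else i div r)"

text \<open>Rows matter modulo \<open>r\<close> only: column 1 continues past row
  \<open>r - 1\<close> by counting on, and \<open>4 * n\<close>, a multiple of \<open>r\<close>,
  stands for 0 so that the subtractions do not truncate. The middle range is a staircase of period
  4: one step up in column 1, across, one step up in column 0, across.\<close>

definition zigzag_row :: "nat \<Rightarrow> nat \<Rightarrow> nat \<Rightarrow> nat \<Rightarrow> nat \<Rightarrow> nat" where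
  "zigzag_row n r m u i =
    (if i < r - 2 * m then i
     else if i < r + 2 * m then r - 2 * m - 1 + (i - (r - 2 * m) + 1) div 2
     else if i < 2 * r then r - 1 + (i - (r + 2 * m))
     else if i div r < u then 4 * n - 2 * m - i div r + i mod r
     else 4 * n - 2 * m - 2 * u + i div r - i mod r)"

lemma zigzag_later:
  assumes "2 \<le> k" "j < r" "2 * m + 2 \<le> r"
  shows "zigzag_col r m (k * r + j) = k"
    "zigzag_row n r m u (k * r + j) =
      (if k < u then 4 * n - 2 * m - k + j else 4 * n - 2 * m - 2 * u + k - j)"
proof -
  have "2 * r \<le> k * r" using assms by (intro mult_le_mono1)
  then have "\<not> k * r + j < r - 2 * m" "\<not> k * r + j < r + 2 * m" "\<not> k * r + j < 2 * r"
    using assms by linarith+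
  then show "zigzag_col r m (k * r + j) = k" "zigzag_row n r m u (k * r + j) =
      (if k < u then 4 * n - 2 * m - k + j else 4 * n - 2 * m - 2 * u + k - j)"
    using assms by (simp_all add: zigzag_col_def zigzag_row_def)
qed

lemma zigzag_first:
  assumes "i < r - 2 * m"
  shows "zigzag_col r m i = 0" "zigzag_row n r m u i = i"
  using assms by (simp_all add: zigzag_col_def zigzag_row_def)

lemma zigzag_middle:
  assumes "j < 4 * m" "2 * m + 2 \<le> r"
  shows "zigzag_col r m (r - 2 * m + j) = (if j mod 4 < 2 then 1 else 0)"
    "zigzag_row n r m u (r - 2 * m + j) = r - 2 * m - 1 + (j + 1) div 2"
proof -
  have "\<not> r - 2 * m + j < r - 2 * m" "r - 2 * m + j < r + 2 * m" using assms by linarith+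
  then show "zigzag_col r m (r - 2 * m + j) = (if j mod 4 < 2 then 1 else 0)"
    "zigzag_row n r m u (r - 2 * m + j) = r - 2 * m - 1 + (j + 1) div 2"
    by (simp_all only: zigzag_col_def zigzag_row_def if_True if_False add_diff_cancel_left')
qed

lemma zigzag_second:
  assumes "j < r - 2 * m"
  shows "zigzag_col r m (r + 2 * m + j) = 1" "zigzag_row n r m u (r + 2 * m + j) = r - 1 + j"
proof -
  have "\<not> r + 2 * m + j < r - 2 * m" "\<not> r + 2 * m + j < r + 2 * m" "r + 2 * m + j < 2 * r"
    using assms by linarith+
  then show "zigzag_col r m (r + 2 * m + j) = 1" "zigzag_row n r m u (r + 2 * m + j) = r - 1 + j"
    by (simp_all only: zigzag_col_def zigzag_row_def if_True if_False add_diff_cancel_left')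
qed

text \<open>Inverts the staircase: the offset of the \<open>e\<close>-th vertex visited in column 1,
  then of the \<open>e\<close>-th one in column 0. Each period of four positions visits two vertices
  in each column.\<close>

lemma zigzag_position:
  fixes e m :: nat
  assumes "e < 2 * m"
  shows "4 * (e div 2) + e mod 2 < 4 * m" "(4 * (e div 2) + e mod 2) mod 4 < 2"
    "(4 * (e div 2) + e mod 2 + 1) div 2 = e"
    "4 * (e div 2) + 2 + e mod 2 < 4 * m" "\<not> (4 * (e div 2) + 2 + e mod 2) mod 4 < 2"
    "(4 * (e div 2) + 2 + e mod 2 + 1) div 2 = e + 1"
proof -
  have "e div 2 < m" using assms by (simp add: less_mult_imp_div_less mult.commute)
  moreover have "e mod 2 < 2" by simp
  ultimately show "4 * (e div 2) + e mod 2 < 4 * m" "4 * (e div 2) + 2 + e mod 2 < 4 * m"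
    by linarith+
  have "(4 * q) mod 4 < 2" "(4 * q + 1) div 2 = 2 * q" "\<not> (4 * q + 2) mod 4 < 2"
    "(4 * q + 1) mod 4 < 2" "(4 * q + 2) div 2 = 2 * q + 1" "\<not> (4 * q + 3) mod 4 < 2"
    "(4 * q + 3) div 2 = 2 * q + 1" "(4 * q + 4) div 2 = 2 * q + 2" for q :: nat by presburger+
  note * = this
  have "(4 * q + s) mod 4 < 2 \<and> (4 * q + s + 1) div 2 = 2 * q + s \<and>
    \<not> (4 * q + 2 + s) mod 4 < 2 \<and> (4 * q + 2 + s + 1) div 2 = 2 * q + s + 1" if "s < 2" for q s :: nat
  proof -
    from that consider "s = 0" | "s = 1" by linarith
    then show ?thesis
    proof cases
      case 1
      then show ?thesis using *(1,2,3,7)[of q] by (simp add: add.assoc)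
    next
      case 2
      then show ?thesis using *(4,5,6,8)[of q] by (simp add: add.assoc)
    qed
  qed
  from this[OF \<open>e mod 2 < 2\<close>, of "e div 2"]
  show "(4 * (e div 2) + e mod 2) mod 4 < 2" "(4 * (e div 2) + e mod 2 + 1) div 2 = e"
    "\<not> (4 * (e div 2) + 2 + e mod 2) mod 4 < 2" "(4 * (e div 2) + 2 + e mod 2 + 1) div 2 = e + 1"
    unfolding mult_div_mod_eq by blast+
qed

text \<open>In the staircase, a step from an even offset is along a column, and a step from an odd
  offset is across.\<close>

lemma even_position:
  fixes j m :: nat
  assumes "even j" "j < 4 * m"
  shows "Suc j < 4 * m" "Suc j mod 4 < 2 \<longleftrightarrow> j mod 4 < 2" "(Suc j + 1) div 2 = Suc ((j + 1) div 2)"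
proof -
  show "Suc j < 4 * m" using assms by (metis Suc_lessI even_Suc dvd_mult2 even_numeral)
  show "Suc j mod 4 < 2 \<longleftrightarrow> j mod 4 < 2" using assms(1) by presburger
  show "(Suc j + 1) div 2 = Suc ((j + 1) div 2)" using assms(1) by presburger
qed

lemma odd_position:
  fixes j :: nat
  assumes "odd j"
  shows "Suc j = 2 * ((j + 1) div 2)" "(Suc j + 1) div 2 = (j + 1) div 2"
    "Suc j mod 4 < 2 \<longleftrightarrow> \<not> j mod 4 < 2"
proof -
  show "Suc j = 2 * ((j + 1) div 2)" using assms by presburger
  show "(Suc j + 1) div 2 = (j + 1) div 2" using assms by presburger
  show "Suc j mod 4 < 2 \<longleftrightarrow> \<not> j mod 4 < 2" using assms by presburger
qed

text \<open>Going up a whole column adds \<open>r - 1\<close>, that is -1 modulo \<open>r\<close>,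
  to the row. The total displacement before the seam is
  \<open>-(2 * m + 2) - (u - 2) + (g - u) = g - 2 * m - 2 * u\<close>, which is \<open>-A\<close> by
  assumption. The seam edge adds \<open>A\<close> and thus closes the tour.\<close>

lemma (in directed_stripes) zigzag_tour:
  assumes m: "2 * m + 2 \<le> r" and u: "2 \<le> u" "u \<le> g" and g3: "3 \<le> g"
    and A: "A + g = 2 * m + 2 * u" "[g * a2 = A * b] (mod n)"
  defines "xs \<equiv> walk (zigzag_col r m) (zigzag_row n r m u)"
  shows "is_tour n xs" "tour_cost n a1 a2 xs \<le> enat (g + 2 * m)"
proof -
  define C where "C = zigzag_col r m"
  define R where "R = zigzag_row n r m u"
  \<comment> \<open>The \<open>2 * m + 1\<close> crossings inside the first two columns, then the
    exits from these and from each later column. The exit with \<open>k = g\<close> is the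
    seam.\<close>
  define H where "H = (\<lambda>e. r - 2 * m - 1 + 2 * e) ` {..2 * m} \<union> (\<lambda>k. k * r - 1) ` {2..g}"
  have n2: "2 * g \<le> n" "2 * r \<le> n" "3 * r \<le> n"
    using mult_le_mono2[OF r2, of g] mult_le_mono1[OF g2, of r] mult_le_mono1[OF g3, of r] n_eq
    by (simp_all add: mult.commute)
  have n4r: "4 * n = 4 * g * r" using n_eq by simp
  have first: "C i = 0" "R i = i" if "i < r - 2 * m" for i
    using zigzag_first[OF that] by (simp_all add: C_def R_def)
  have middle: "C (r - 2 * m + j) = (if j mod 4 < 2 then 1 else 0)"
    "R (r - 2 * m + j) = r - 2 * m - 1 + (j + 1) div 2" if "j < 4 * m" for j
    using zigzag_middle[OF that m] by (simp_all only: C_def R_def)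
  have second: "C (r + 2 * m + j) = 1" "R (r + 2 * m + j) = r - 1 + j" if "j < r - 2 * m" for j
    using zigzag_second[OF that] by (simp_all add: C_def R_def)
  have later: "C (k * r + j) = k"
    "R (k * r + j) = (if k < u then 4 * n - 2 * m - k + j else 4 * n - 2 * m - 2 * u + k - j)"
    if "2 \<le> k" "j < r" for k j
    using zigzag_later[OF that m] by (simp_all only: C_def R_def)
  have pos: "k * r + j < n" if "k < g" "j < r" for k j
  proof -
    have "Suc k * r \<le> g * r" using that by (intro mult_le_mono1) simp
    then show ?thesis using that n_eq by simp
  qed
  have cover: "\<exists>i<n. C i = k \<and> [R i = x] (mod r)" if kx: "k < g" "x < r" for k x
  proof -
    \<comment> \<open>Column 0 before and inside the staircase; column 1 inside the staircase, in
      row \<open>r - 1\<close>, and after the wrap to row 0; later columns traversed upwards and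
      downwards.\<close>
    consider "k = 0" "x < r - 2 * m" | "k = 0" "r - 2 * m \<le> x"
      | "k = 1" "r - 2 * m - 1 \<le> x" "x < r - 1" | "k = 1" "x = r - 1"
      | "k = 1" "x < r - 2 * m - 1" | "2 \<le> k" "k < u" | "2 \<le> k" "u \<le> k"
    proof -
      assume *: "k = 0 \<Longrightarrow> x < r - 2 * m \<Longrightarrow> thesis" "k = 0 \<Longrightarrow> r - 2 * m \<le> x \<Longrightarrow> thesis"
        "k = 1 \<Longrightarrow> r - 2 * m - 1 \<le> x \<Longrightarrow> x < r - 1 \<Longrightarrow> thesis" "k = 1 \<Longrightarrow> x = r - 1 \<Longrightarrow> thesis"
        "k = 1 \<Longrightarrow> x < r - 2 * m - 1 \<Longrightarrow> thesis" "2 \<le> k \<Longrightarrow> k < u \<Longrightarrow> thesis"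
        "2 \<le> k \<Longrightarrow> u \<le> k \<Longrightarrow> thesis"
      have "k = 0 \<or> k = 1 \<or> 2 \<le> k" "x < r - 1 \<or> x = r - 1" using kx by linarith+
      then show thesis using * not_le by blast
    qed
    then show ?thesis
    proof cases
      case 1
      then show ?thesis using first[of x] n2 by (intro exI[of _ x]) simp
    next
      case 2
      define e where "e = x - (r - 2 * m)"
      define j where "j = 4 * (e div 2) + 2 + e mod 2"
      have x: "x = r - 2 * m + e" "e < 2 * m" using 2 kx m by (simp_all add: e_def)
      have j: "j < 4 * m" "\<not> j mod 4 < 2" "(j + 1) div 2 = e + 1"
        unfolding j_def by (fact zigzag_position[OF x(2)])+
      have "C (r - 2 * m + j) = k" "R (r - 2 * m + j) = x" using middle[OF j(1)] j x 2 m by simp_all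
      moreover have "r - 2 * m + j < n" using j(1) m n2 by linarith
      ultimately show ?thesis by auto
    next
      case 3
      define e where "e = x - (r - 2 * m - 1)"
      define j where "j = 4 * (e div 2) + e mod 2"
      have x: "x = r - 2 * m - 1 + e" "e < 2 * m" using 3 m by (simp_all add: e_def)
      have j: "j < 4 * m" "j mod 4 < 2" "(j + 1) div 2 = e"
        unfolding j_def by (fact zigzag_position[OF x(2)])+
      have "C (r - 2 * m + j) = k" "R (r - 2 * m + j) = x" using middle[OF j(1)] j x 3 m by simp_all
      moreover have "r - 2 * m + j < n" using j(1) m n2 by linarith
      ultimately show ?thesis by auto
    next
      case 4
      then show ?thesis using second[of 0] m n2 by (intro exI[of _ "r + 2 * m"]) simp
    next
      case 5
      then have "R (r + 2 * m + Suc x) = r + x" "C (r + 2 * m + Suc x) = 1"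
        using second[of "Suc x"] by simp_all
      then show ?thesis using 5 m n2 by (intro exI[of _ "r + 2 * m + Suc x"]) (simp add: cong_def)
    next
      case 6
      define j where "j = (x + k + 2 * m) mod r"
      have j: "j < r" using r2 by (simp add: j_def)
      have le: "2 * m + k \<le> 4 * n" using 6 u m n2 by linarith
      have "[4 * n - 2 * m - k + j = x] (mod r)"
      proof -
        have "[4 * n - 2 * m - k + j = 4 * n - 2 * m - k + (x + k + 2 * m)] (mod r)"
          unfolding j_def by (intro cong_add cong_refl) (simp add: cong_def)
        also have "4 * n - 2 * m - k + (x + k + 2 * m) = x + (4 * g) * r"
          using le n4r by linarith
        finally show ?thesis by (simp add: cong_def)
      qed
      then show ?thesis using later[OF 6(1) j] pos[OF kx(1) j] 6
        by (intro exI[of _ "k * r + j"]) simp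
    next
      case 7
      define y where "y = 4 * n - 2 * m - 2 * u + k - x"
      have le: "2 * m + 2 * u + r \<le> 4 * n" using u m n2 by linarith
      define j where "j = y mod r"
      have j: "j < r" using r2 by (simp add: j_def)
      have "[4 * n - 2 * m - 2 * u + k - j = x] (mod r)"
      proof (rule cong_multipleI)
        have "y = y div r * r + j" by (simp add: j_def)
        moreover have "4 * n - 2 * m - 2 * u + k = y + x" using le kx by (simp add: y_def)
        ultimately show "4 * n - 2 * m - 2 * u + k - j = x + y div r * r" by linarith
      qed
      then show ?thesis using later[OF 7(1) j] pos[OF kx(1) j] 7
        by (intro exI[of _ "k * r + j"]) simp
    qed
  qed
  define V where "V i i' \<longleftrightarrow> C i' = C i \<and> ([R i' = Suc (R i)] (mod r) \<or> [R i = Suc (R i')] (mod r))" for i i'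
  define E where "E i i' \<longleftrightarrow> stripe_edge n a2 (vert (C i) (R i)) (vert (C i') (R i'))" for i i'
  have VI: "V i i'" if "C i' = C i" "R i' = Suc (R i) \<or> R i = Suc (R i')" for i i'
    using that by (auto simp: V_def)
  have EI: "E i i'" if "C i' = Suc (C i)" "[R i' = R i] (mod r)" for i i'
    using that hor_edge by (simp add: E_def)
  have EI': "E i i'" if "C i = Suc (C i')" "[R i = R i'] (mod r)" for i i'
    using that hor_edge stripe_edge_commute by (simp add: E_def)
  have inH1: "r - 2 * m - 1 + 2 * e \<in> H" if "e \<le> 2 * m" for e
    using that by (auto simp: H_def)
  have inH2: "i \<in> H" if "Suc i = k * r" "2 \<le> k" "k \<le> g" for i k
    using that unfolding H_def by (intro UnI2 image_eqI[of _ _ k]) auto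
  have Hcases: "(\<exists>e\<le>2 * m. Suc i = r - 2 * m + 2 * e) \<or> (\<exists>k\<ge>2. Suc i = k * r)" if "i \<in> H" for i
    using that unfolding H_def
  proof
    assume "i \<in> (\<lambda>k. k * r - 1) ` {2..g}"
    then obtain k where k: "2 \<le> k" "i = k * r - 1" by auto
    then have "2 * r \<le> k * r" by (intro mult_le_mono1)
    then have "Suc i = k * r" using k r2 by linarith
    then show ?thesis using k by blast
  qed (use m in auto)
  have large: "2 * r \<le> k * r" if "2 \<le> k" for k
    using that by (intro mult_le_mono1)
  have VE: "(i \<notin> H \<longrightarrow> V i (Suc i mod n)) \<and> (i \<in> H \<longrightarrow> E i (Suc i mod n))" if i: "i < n" for i
  proof -
    have "i < 2 * r \<or> (\<exists>k j. 2 \<le> k \<and> k < g \<and> j < r \<and> i = k * r + j)"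
    proof (cases "i < 2 * r")
      case False
      have "i div r < g" using i n_eq r2 by (simp add: less_mult_imp_div_less)
      moreover have "2 \<le> i div r" using False r2 by (simp add: less_eq_div_iff_mult_less_eq)
      moreover have "i mod r < r" using r2 by simp
      ultimately show ?thesis by (metis div_mult_mod_eq)
    qed simp
    \<comment> \<open>The kinds of steps in the order of the tour: up column 0, out of it; in the
      staircase up, across, and its last crossing; up column 1, out of it; inside a later column, to
      the next one, and over the seam.\<close>
    then consider "Suc i < r - 2 * m" | "Suc i = r - 2 * m"
      | j where "i = r - 2 * m + j" "j < 4 * m" "even j"
      | j where "i = r - 2 * m + j" "j < 4 * m" "odd j" "Suc j < 4 * m"
      | j where "i = r - 2 * m + j" "odd j" "Suc j = 4 * m"
      | j where "i = r + 2 * m + j" "Suc j < r - 2 * m" | "Suc i = 2 * r"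
      | k j where "2 \<le> k" "k < g" "Suc j < r" "i = k * r + j"
      | k where "2 \<le> k" "Suc k < g" "i = k * r + (r - 1)"
      | "i = (g - 1) * r + (r - 1)"
    proof (cases "i < 2 * r")
      case True
      show ?thesis
      proof (cases "i < r - 2 * m")
        case True
        then show ?thesis using that(1,2) by linarith
      next
        case F1: False
        show ?thesis
        proof (cases "i < r + 2 * m")
          case T: True
          then have "i = r - 2 * m + (i - (r - 2 * m))" "i - (r - 2 * m) < 4 * m"
            using F1 m by linarith+
          then show ?thesis using that(3,4,5) by (metis Suc_lessI)
        next
          case False
          then have j: "i = r + 2 * m + (i - (r + 2 * m))" by simp
          show ?thesis
          proof (cases "Suc i = 2 * r")
            case True
            then show ?thesis by (rule that(7))
          next
            case False
            then have "Suc (i - (r + 2 * m)) < r - 2 * m" using True j m by linarith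
            with j show ?thesis by (rule that(6))
          qed
        qed
      qed
    next
      case False
      assume "i < 2 * r \<or> (\<exists>k j. 2 \<le> k \<and> k < g \<and> j < r \<and> i = k * r + j)"
      then obtain k j where kj: "2 \<le> k" "k < g" "j < r" "i = k * r + j" using False by blast
      consider "Suc j < r" | "j = r - 1" "Suc k < g" | "j = r - 1" "k = g - 1" using kj by linarith
      then show ?thesis by cases (use kj that(8,9,10) in blast)+
    qed
    then show ?thesis
    proof cases
      case 1
      have "i \<notin> H"
      proof
        assume "i \<in> H"
        then consider e where "Suc i = r - 2 * m + 2 * e" | k where "2 \<le> k" "Suc i = k * r"
          using Hcases by blast
        then show False
        proof cases
          case 1
          then show False using \<open>Suc i < r - 2 * m\<close> by linarith
        next
          case 2
          then show False using \<open>Suc i < r - 2 * m\<close> large[of k] by linarith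
        qed
      qed
      moreover have "Suc i mod n = Suc i" using 1 n2 by simp
      ultimately show ?thesis using 1 first[of i] first[of "Suc i"] by (auto intro!: VI)
    next
      case 2
      then have i0: "i = r - 2 * m - 1 + 2 * 0" using m by simp
      have "i \<in> H" unfolding i0 by (rule inH1) simp
      moreover have "E i (Suc i)"
      proof (cases "m = 0")
        \<comment> \<open>Without a staircase the first crossing leads directly into the final part
          of column 1.\<close>
        case True
        then show ?thesis using 2 first[of i] second[of 0] r2 by (intro EI) auto
      next
        case False
        have "r - Suc (2 * m) = i" using 2 by linarith
        then show ?thesis using False 2 first[of i] middle[of 0] m by (intro EI) auto
      qed
      moreover have "Suc i mod n = Suc i" using 2 n2 m by simp
      ultimately show ?thesis by simp
    next
      case (3 j)
      have "Suc j < 4 * m" "(Suc j) mod 4 < 2 \<longleftrightarrow> j mod 4 < 2" "(Suc j + 1) div 2 = Suc ((j + 1) div 2)"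
        using even_position[OF 3(3,2)] by simp_all
      then have "V i (Suc i)" using 3 middle[of j] middle[of "Suc j"] by (intro VI) auto
      moreover have "i \<notin> H"
      proof
        assume "i \<in> H"
        then consider e where "Suc i = r - 2 * m + 2 * e" | k where "2 \<le> k" "Suc i = k * r"
          using Hcases by blast
        then show False
        proof cases
          case 1
          then have "Suc j = 2 * e" using 3 by simp
          then show False using 3(3) by presburger
        next
          case 2
          then show False using 3 large[of k] m by linarith
        qed
      qed
      moreover have "Suc i mod n = Suc i" using 3 n2 m by simp
      ultimately show ?thesis by simp
    next
      case (4 j)
      define e where "e = (j + 1) div 2"
      have e: "Suc j = 2 * e" "e \<le> 2 * m" "(Suc j + 1) div 2 = (j + 1) div 2"
        "(Suc j) mod 4 < 2 \<longleftrightarrow> \<not> j mod 4 < 2"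
        using odd_position[OF 4(3)] 4(2) by (simp_all add: e_def)
      have ie: "i = r - 2 * m - 1 + 2 * e" using 4 e m by simp
      have "i \<in> H" unfolding ie using e by (intro inH1)
      moreover have "E i (Suc i)"
      proof (cases "j mod 4 < 2")
        case True
        then show ?thesis using 4 middle[of j] middle[of "Suc j"] e(3,4) by (intro EI') auto
      next
        case False
        then show ?thesis using 4 middle[of j] middle[of "Suc j"] e(3,4) by (intro EI) auto
      qed
      moreover have "Suc i mod n = Suc i" using 4 n2 m by simp
      ultimately show ?thesis by simp
    next
      case (5 j)
      have j: "(j + 1) div 2 = 2 * m" "\<not> j mod 4 < 2" using odd_position[OF 5(2)] 5(3) by simp_all
      have ie: "i = r - 2 * m - 1 + 2 * (2 * m)" "Suc i = r + 2 * m + 0" using 5 m by simp_all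
      have "i \<in> H" unfolding ie by (intro inH1) simp
      moreover have "E i (Suc i)"
        using 5 middle[of j] second[of 0] j ie(2) m by (intro EI) auto
      moreover have "Suc i mod n = Suc i" using ie n2 m by simp
      ultimately show ?thesis by simp
    next
      case (6 j)
      have "i \<notin> H"
      proof
        assume "i \<in> H"
        then consider e where "Suc i = r - 2 * m + 2 * e" "e \<le> 2 * m" | k where "2 \<le> k" "Suc i = k * r"
          using Hcases by blast
        then show False
        proof cases
          case 1
          then show False using 6 m by linarith
        next
          case 2
          then show False using 6 large[of k] m by linarith
        qed
      qed
      moreover have "V i (Suc i)" using 6 second[of j] second[of "Suc j"] by (intro VI) auto
      moreover have "Suc i mod n = Suc i" using 6 n2 m by simp
      ultimately show ?thesis by simp
    next
      case 7
      define j where "j = r - 2 * m - 1"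
      have j: "j < r - 2 * m" "i = r + 2 * m + j" using 7 m by (simp_all add: j_def)
      have "i \<in> H" using 7 g2 by (intro inH2[of _ 2]) auto
      moreover have "E i (Suc i)"
      proof (rule EI)
        have "C (Suc i) = 2" unfolding 7 using later[of 2 0] r2 by simp
        then show "C (Suc i) = Suc (C i)" using second[OF j(1)] j(2) by simp
        have "2 * m + 4 \<le> 4 * n" using m n2 g3 r2 by linarith
        \<comment> \<open>For \<open>u = 2\<close> the downward formula applies already in column 2,
          and it starts in the same row.\<close>
        then have "R (Suc i) = 4 * n - 2 * m - 2"
          unfolding 7 using later[of 2 0] r2 u by (cases "2 < u") auto
        moreover have "R i = r - 1 + j" using second[OF j(1)] j(2) by simp
        moreover have "4 * n - 2 * m - 2 = (r - 1 + j) + (4 * g - 2) * r"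
          using n4r m g2 n2 by (simp add: j_def diff_mult_distrib)
        ultimately show "[R (Suc i) = R i] (mod r)"
          by (intro cong_multipleI[of _ _ "4 * g - 2"]) simp
      qed
      moreover have "Suc i mod n = Suc i" using 7 n2 r2 by simp
      ultimately show ?thesis by simp
    next
      case (8 k j)
      have "i \<notin> H"
      proof
        assume "i \<in> H"
        then consider e where "Suc i = r - 2 * m + 2 * e" "e \<le> 2 * m" | l where "2 \<le> l" "Suc i = l * r"
          using Hcases by blast
        then show False
        proof cases
          case 1
          then show False using 8 large[of k] m by linarith
        next
          case 2
          then have "(k * r + Suc j) mod r = (l * r) mod r" using 8 by simp
          then show False using 8 by simp
        qed
      qed
      moreover have "V i (Suc i)"
      proof (rule VI)
        have "2 * m + 2 * u + r \<le> 4 * n" using u m n2 by linarith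
        then show "R (Suc i) = Suc (R i) \<or> R i = Suc (R (Suc i))"
          using 8 later[of k j] later[of k "Suc j"] by auto
      qed (use 8 later[of k j] later[of k "Suc j"] in simp)
      moreover have "Suc i mod n = Suc i" using pos[of k "Suc j"] 8 by simp
      ultimately show ?thesis by simp
    next
      case (9 k)
      have si: "Suc i = Suc k * r + 0" using 9 r2 by simp
      have "i \<in> H" using 9 si by (intro inH2[of _ "Suc k"]) auto
      moreover have "E i (Suc i)"
      proof (rule EI)
        have "C (Suc i) = Suc k" unfolding si using 9 r2 by (intro later(1)) auto
        moreover have "C i = k" unfolding 9(3) using 9 r2 by (intro later(1)) auto
        ultimately show "C (Suc i) = Suc (C i)" by simp
        have le: "2 * m + 2 * u + r \<le> 4 * n" using u m n2 by linarith
        have Ri: "R i = (if k < u then 4 * n - 2 * m - k + (r - 1) else 4 * n - 2 * m - 2 * u + k - (r - 1))"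
          unfolding 9(3) using 9 r2 by (intro later(2)) auto
        have Rs: "R (Suc i) = (if Suc k < u then 4 * n - 2 * m - Suc k else 4 * n - 2 * m - 2 * u + Suc k)"
          unfolding si using later(2)[of "Suc k" 0] 9 r2 by simp
        \<comment> \<open>At \<open>Suc k = u\<close> the direction reverses; both formulas give the
          same starting row there.\<close>
        consider "Suc k < u" | "Suc k = u" | "u \<le> k" by linarith
        then show "[R (Suc i) = R i] (mod r)"
        proof cases
          case 1
          then have "R i = R (Suc i) + 1 * r" using Ri Rs le r2 by simp
          then show ?thesis by (intro cong_sym[OF cong_multipleI])
        next
          case 2
          then have "R i = R (Suc i) + 1 * r" using Ri Rs le r2 by auto
          then show ?thesis by (intro cong_sym[OF cong_multipleI])
        next
          case 3
          then have "R (Suc i) = R i + 1 * r" using Ri Rs le r2 by simp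
          then show ?thesis by (rule cong_multipleI)
        qed
      qed
      moreover have "Suc i < n" using si pos[of "Suc k" 0] 9 r2 by simp
      ultimately show ?thesis by simp
    next
      case 10
      have si: "Suc i = g * r" using 10 g2 r2 by (cases g) simp_all
      have "i \<in> H" using si g2 by (intro inH2[of _ g]) auto
      moreover have "Suc i mod n = 0" using si n_eq by simp
      moreover have "E i 0"
      proof -
        have z: "C 0 = 0" "R 0 = 0" using first[of 0] m by simp_all
        have Ci: "C i = g - 1" unfolding 10 using g3 r2 by (intro later(1)) auto
        have le: "2 * m + 2 * u + r + g \<le> 4 * n" using u m n2 by linarith
        have Ri: "R i = (if g - 1 < u then 4 * n - 2 * m - (g - 1) + (r - 1) else 4 * n - 2 * m - 2 * u + (g - 1) - (r - 1))"
          unfolding 10 using g3 r2 by (intro later(2)) auto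
        \<comment> \<open>The last column is traversed upwards only if \<open>u = g\<close>. In both
          cases the displacement is cancelled by the seam shift.\<close>
        have "[0 = R i + A] (mod r)"
        proof (cases "g - 1 < u")
          case True
          then have "u = g" using u by simp
          then have "R i + A = 0 + (4 * g + 1) * r" using Ri A(1) True n4r le g2 r2 by simp
          then show ?thesis by (intro cong_sym[OF cong_multipleI])
        next
          case False
          then have "R i = 4 * n - 2 * m - 2 * u + (g - 1) - (r - 1)" using Ri by simp
          then have "R i + A + r = 4 * n" using A(1) le g2 r2 by linarith
          moreover have "r dvd 4 * n" unfolding n4r by simp
          ultimately have "r dvd R i + A + r" by simp
          then have "r dvd R i + A" by (simp only: dvd_add_triv_right_iff)
          then show ?thesis by (simp add: cong_def)
        qed
        then show ?thesis using seam_edge[OF A(2)] z Ci by (simp add: E_def)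
      qed
      ultimately show ?thesis by simp
    qed
  qed
  have "card H \<le> card ((\<lambda>e. r - 2 * m - 1 + 2 * e) ` {..2 * m}) + card ((\<lambda>k. k * r - 1) ` {2..g})"
    unfolding H_def by (rule card_Un_le)
  also have "\<dots> \<le> card {..2 * m} + card {2..g}"
    by (intro add_mono card_image_le) simp_all
  finally have cH: "card H \<le> g + 2 * m" using g2 by simp
  have "finite H" by (simp add: H_def)
  from walk_tour[of C R H, OF cover _ _ this cH]
  show "is_tour n xs" "tour_cost n a1 a2 xs \<le> enat (g + 2 * m)"
    using VE unfolding xs_def C_def[symmetric] R_def[symmetric] V_def E_def by blast+
qed

text \<open>A tour that crosses every gap an odd number of times needs \<open>max g A\<close> edges of length \<open>a2\<close>,
  where \<open>A\<close> is the smallest of \<open>t\<close> and \<open>r - t\<close> that has the parity of \<open>g\<close>. The value \<open>2 * n\<close>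
  stands for infinity.\<close>

definition shift_candidate :: "nat \<Rightarrow> nat \<Rightarrow> nat \<Rightarrow> nat" where
  "shift_candidate n g x = (if (x + g) mod 2 < 1 then x else 2 * n)"

definition shift :: "nat \<Rightarrow> nat \<Rightarrow> nat \<Rightarrow> nat \<Rightarrow> nat" where
  "shift n g r t = (if shift_candidate n g (r - t) < shift_candidate n g t
     then shift_candidate n g (r - t) else shift_candidate n g t)"

definition row_step :: "nat \<Rightarrow> nat \<Rightarrow> nat \<Rightarrow> nat \<Rightarrow> nat \<Rightarrow> nat" where
  "row_step n a1 g r t = (if shift_candidate n g (r - t) < shift_candidate n g t then n - a1 else a1)"

definition odd_cost :: "nat \<Rightarrow> nat \<Rightarrow> nat" where
  "odd_cost g A = (if g < A then A else g)"

text \<open>A number and not a truth value, because it is one of the emitted parameters.\<close>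

definition is_zigzag :: "nat \<Rightarrow> nat \<Rightarrow> nat" where
  "is_zigzag g M = (if M < 2 * (g - 1) then 1 else 0)"

definition tour_vertex :: "nat \<Rightarrow> nat \<Rightarrow> nat \<Rightarrow> nat \<Rightarrow> nat \<Rightarrow> nat \<Rightarrow> nat \<Rightarrow> nat \<Rightarrow> nat \<Rightarrow> nat" where
  "tour_vertex n a2 g r z m u b i =
    ((if 0 < z then zigzag_col r m i else comb_col g r i) * a2 +
     (if 0 < z then zigzag_row n r m u i else comb_row g r i) * b) mod n"

text \<open>The lower bound leaves the smaller of \<open>2 * (g - 1)\<close> and
  \<open>max g A\<close>. The comb attains the first value, and the zigzag tour attains the second
  whenever that is the smaller one.\<close>

theorem (in stripes_shift) optimal_tour_vertex:
  defines "A \<equiv> shift n g r t"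
  defines "z \<equiv> is_zigzag g (odd_cost g A)" and "m \<equiv> (odd_cost g A - g) div 2"
  defines "xs \<equiv> map (tour_vertex n a2 g r z m ((A + g - 2 * m) div 2) (row_step n a1 g r t)) [0..<n]"
  shows "optimal_tour n a1 a2 xs"
    "tour_cost n a1 a2 xs = enat (if 0 < z then g + 2 * m else 2 * (g - 1))"
proof -
  define b where "b = row_step n a1 g r t"
  define u where "u = (A + g - 2 * m) div 2"
  define M where "M = odd_cost g A"
  define c where "c = (if 0 < z then g + 2 * m else 2 * (g - 1))"
  interpret directed_stripes n a1 a2 g r b
    by unfold_locales (auto simp: b_def row_step_def)
  have M: "M = max g A" by (simp add: M_def odd_cost_def)
  have z: "0 < z \<longleftrightarrow> M < 2 * (g - 1)" by (simp add: z_def is_zigzag_def M_def)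
  have m: "m = (M - g) div 2" by (simp add: m_def M_def)
  have A_le: "A \<le> x" if x: "x \<in> {t, r - t}" "even (x + g)" for x
  proof -
    have "shift_candidate n g x = x" using x(2) by (simp add: shift_candidate_def)
    moreover have "A \<le> shift_candidate n g t" "A \<le> shift_candidate n g (r - t)"
      by (simp_all add: A_def shift_def)
    ultimately show ?thesis using x(1) by auto
  qed
  have lower: "enat (if 0 < z then M else 2 * (g - 1)) \<le> tour_cost n a1 a2 ys" if "is_tour n ys" for ys
    using tour_cost_bound[OF that]
  proof
    assume "enat (2 * (g - 1)) \<le> tour_cost n a1 a2 ys"
    moreover have "enat (if 0 < z then M else 2 * (g - 1)) \<le> enat (2 * (g - 1))"
      using z by simp
    ultimately show ?thesis by (rule order_trans[rotated])
  next
    assume "\<exists>A \<in> {t, r - t}. even (A + g) \<and> enat (max g A) \<le> tour_cost n a1 a2 ys"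
    then obtain x where x: "x \<in> {t, r - t}" "even (x + g)" "enat (max g x) \<le> tour_cost n a1 a2 ys"
      by blast
    have "M \<le> max g x" unfolding M using A_le[OF x(1,2)] by simp
    then have "enat (if 0 < z then M else 2 * (g - 1)) \<le> enat (max g x)"
      using z by simp
    then show ?thesis using x(3) by (rule order_trans)
  qed
  have upper: "is_tour n xs \<and> tour_cost n a1 a2 xs \<le> enat c \<and> c = (if 0 < z then M else 2 * (g - 1))"
  proof (cases "0 < z")
    case False
    then have "xs = walk (comb_col g r) (comb_row g r)"
      by (simp add: xs_def walk_def vert_def tour_vertex_def b_def[symmetric])
    then show ?thesis using comb_tour False by (simp add: c_def)
  next
    case True
    then have lt: "M < 2 * (g - 1)" using z by simp
    have "2 * g \<le> n" using mult_le_mono2[OF r2, of g] n_eq by (simp add: mult.commute)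
    \<comment> \<open>A value below \<open>2 * (g - 1)\<close> cannot come from the stand-in for
      infinity, so \<open>A\<close> is a genuine shift with the parity of \<open>g\<close>.\<close>
    then have An: "A < 2 * n" using lt M by linarith
    have A: "(A = t \<and> b = a1 \<or> A = r - t \<and> b = n - a1)" "even (A + g)"
    proof -
      have sc: "shift_candidate n g x = x \<and> even (x + g)" if "shift_candidate n g x < 2 * n" for x
        using that by (auto simp: shift_candidate_def even_iff_mod_2_eq_zero split: if_splits)
      show "(A = t \<and> b = a1 \<or> A = r - t \<and> b = n - a1)" "even (A + g)"
        using sc[of t] sc[of "r - t"] An unfolding A_def b_def shift_def row_step_def
        by (cases "shift_candidate n g (r - t) < shift_candidate n g t"; simp)+
    qed
    have Ar: "A \<le> r" using A(1) t by auto
    have cong: "[g * a2 = A * b] (mod n)"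
      using A(1)
    proof
      assume "A = t \<and> b = a1"
      then show ?thesis using t by simp
    next
      assume *: "A = r - t \<and> b = n - a1"
      have "[g * a2 + (r - t) * a1 = t * a1 + (r - t) * a1] (mod n)"
        using t by (intro cong_add cong_refl)
      moreover have "t * a1 + (r - t) * a1 = r * a1"
        using t by (simp add: add_mult_distrib[symmetric])
      moreover have "n dvd r * a1" using dvd_r_iff by simp
      moreover have "A * b + (r - t) * a1 = (r - t) * n"
        using * a1_bounds by (simp add: add_mult_distrib2[symmetric])
      ultimately have "[g * a2 + (r - t) * a1 = A * b + (r - t) * a1] (mod n)"
        by (simp add: cong_def)
      then show ?thesis by (simp only: cong_add_rcancel_nat)
    qed
    have M2: "M = g + 2 * m"
    proof (cases "g < A")
      case True
      then have "even (A - g)" using A(2) by simp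
      then show ?thesis using True M m by simp
    qed (use M m in simp)
    have u2: "A + g = 2 * m + 2 * u"
    proof (cases "g < A")
      case True
      then have "A = g + 2 * m" using M M2 by simp
      moreover from this have "A + g - 2 * m = 2 * g" by simp
      ultimately show ?thesis unfolding u_def by simp
    next
      case False
      then have "m = 0" using M M2 by simp
      then show ?thesis using A(2) by (simp add: u_def)
    qed
    have g3: "3 \<le> g" using lt M by linarith
    \<comment> \<open>For \<open>m > 0\<close> the shift \<open>A = g + 2 * m\<close> is at most
      \<open>r\<close>.\<close>
    have "2 * m + 2 \<le> r" using M M2 Ar r2 g3 by linarith
    moreover have "2 \<le> u" using u2 M M2 g3 by linarith
    moreover have "u \<le> g" using u2 M M2 by linarith
    moreover have "xs = walk (zigzag_col r m) (zigzag_row n r m u)"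
      using True by (simp add: xs_def walk_def vert_def tour_vertex_def b_def[symmetric] u_def[symmetric])
    ultimately show ?thesis using zigzag_tour[OF _ _ _ g3 u2 cong] True M2 by (simp add: c_def)
  qed
  then have "tour_cost n a1 a2 xs = enat c" using lower[of xs] by (metis order_antisym)
  then show "tour_cost n a1 a2 xs = enat (if 0 < z then g + 2 * m else 2 * (g - 1))"
    by (simp add: c_def)
  show "optimal_tour n a1 a2 xs"
    unfolding optimal_tour_def using upper lower \<open>tour_cost n a1 a2 xs = enat c\<close> by auto
qed

text \<open>Multiply the Bezout congruence by \<open>a2\<close>; the resulting factor of
  \<open>a1\<close> matters only modulo the order \<open>r\<close>.\<close>

lemma (in stripes) stripes_shift_bezout:
  assumes "[w * a1 = g] (mod n)"
  shows "stripes_shift n a1 a2 g r ((a2 * w) mod r)"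
proof unfold_locales
  show "(a2 * w) mod r < r" using r2 by simp
  have "[(a2 * w) mod r * a1 = a2 * w * a1] (mod n)"
    unfolding cong_a1_iff by (simp add: cong_def)
  moreover have "[a2 * (w * a1) = a2 * g] (mod n)" using assms by (intro cong_mult cong_refl)
  ultimately show "[g * a2 = (a2 * w) mod r * a1] (mod n)"
    by (metis cong_sym cong_trans mult.assoc mult.commute)
qed

section \<open>The algorithm\<close>

definition comb_col_exp :: exp where
  "comb_col_exp = IfLess (Var 3) (Var 4) (Var 3) (Bin Minus (Bin Minus (Var 4) (Num 1))
     (Bin Divide (Bin Minus (Var 3) (Var 4)) (Bin Minus (Var 5) (Num 1))))"

definition comb_row_exp :: exp where
  "comb_row_exp = IfLess (Var 3) (Var 4) (Num 0)
     (IfLess (Bin Modulo (Bin Divide (Bin Minus (Var 3) (Var 4)) (Bin Minus (Var 5) (Num 1))) (Num 2)) (Num 1)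
       (Bin Plus (Num 1) (Bin Modulo (Bin Minus (Var 3) (Var 4)) (Bin Minus (Var 5) (Num 1))))
       (Bin Minus (Bin Minus (Var 5) (Num 1))
         (Bin Modulo (Bin Minus (Var 3) (Var 4)) (Bin Minus (Var 5) (Num 1)))))"

definition zigzag_col_exp :: exp where
  "zigzag_col_exp =
    (let l = Bin Minus (Var 5) (Bin Times (Num 2) (Var 7)) in
     IfLess (Var 3) l (Num 0)
      (IfLess (Var 3) (Bin Plus (Var 5) (Bin Times (Num 2) (Var 7)))
        (IfLess (Bin Modulo (Bin Minus (Var 3) l) (Num 4)) (Num 2) (Num 1) (Num 0))
        (IfLess (Var 3) (Bin Times (Num 2) (Var 5)) (Num 1) (Bin Divide (Var 3) (Var 5)))))"

definition zigzag_row_exp :: exp where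
  "zigzag_row_exp =
    (let l = Bin Minus (Var 5) (Bin Times (Num 2) (Var 7));
       k = Bin Divide (Var 3) (Var 5); j = Bin Modulo (Var 3) (Var 5);
       v = Bin Minus (Bin Times (Num 4) (Var 0)) (Bin Times (Num 2) (Var 7)) in
     IfLess (Var 3) l (Var 3)
      (IfLess (Var 3) (Bin Plus (Var 5) (Bin Times (Num 2) (Var 7)))
        (Bin Plus (Bin Minus l (Num 1)) (Bin Divide (Bin Plus (Bin Minus (Var 3) l) (Num 1)) (Num 2)))
        (IfLess (Var 3) (Bin Times (Num 2) (Var 5))
          (Bin Plus (Bin Minus (Var 5) (Num 1)) (Bin Minus (Var 3) (Bin Plus (Var 5) (Bin Times (Num 2) (Var 7)))))
          (IfLess k (Var 8) (Bin Plus (Bin Minus v k) j)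
            (Bin Minus (Bin Plus (Bin Minus v (Bin Times (Num 2) (Var 8))) k) j)))))"

definition vertex_exp :: exp where
  "vertex_exp = Bin Modulo
    (Bin Plus (Bin Times (IfLess (Num 0) (Var 6) zigzag_col_exp comb_col_exp) (Var 2))
       (Bin Times (IfLess (Num 0) (Var 6) zigzag_row_exp comb_row_exp) (Var 9))) (Var 0)"

lemma val_vertex_exp:
  "val vertex_exp s = tour_vertex (s 0) (s 2) (s 4) (s 5) (s 6) (s 7) (s 8) (s 9) (s 3)"
proof -
  have "val comb_col_exp s = comb_col (s 4) (s 5) (s 3)"
    by (simp add: comb_col_exp_def comb_col_def)
  moreover have "val comb_row_exp s = comb_row (s 4) (s 5) (s 3)"
    by (simp add: comb_row_exp_def comb_row_def even_iff_mod_2_eq_zero)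
  moreover have "val zigzag_col_exp s = zigzag_col (s 5) (s 7) (s 3)"
    by (simp add: zigzag_col_exp_def zigzag_col_def Let_def)
  moreover have "val zigzag_row_exp s = zigzag_row (s 0) (s 5) (s 7) (s 8) (s 3)"
    by (simp add: zigzag_row_exp_def zigzag_row_def Let_def)
  ultimately show ?thesis by (simp add: vertex_exp_def tour_vertex_def)
qed

lemma vars_vertex_exp: "vars_below 40 vertex_exp"
  by (simp add: vertex_exp_def comb_col_exp_def comb_row_exp_def zigzag_col_exp_def
      zigzag_row_exp_def Let_def)

text \<open>The arguments prescribed by \<open>describes\<close> fill registers 0 to 9 in the layout
  of the output loop, so the same program also serves as the body of that loop.\<close>

definition decoder :: prog where
  "decoder = Seq (assign 39 vertex_exp) (Emit 39)"

lemma input_state_10: "input_state [n, a1, a2, i, g, r, z, m, u, b] =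
  (\<lambda>_. 0)(0 := n, 1 := a1, 2 := a2, 3 := i, 4 := g, 5 := r, 6 := z, 7 := m, 8 := u, 9 := b)"
proof
  fix j :: nat
  show "input_state [n, a1, a2, i, g, r, z, m, u, b] j =
    ((\<lambda>_. 0)(0 := n, 1 := a1, 2 := a2, 3 := i, 4 := g, 5 := r, 6 := z, 7 := m, 8 := u, 9 := b)) j"
  proof (cases "j < 10")
    case True
    then have "j \<in> {0, 1, 2, 3, 4, 5, 6, 7, 8, 9}" by auto
    then show ?thesis by (elim insertE emptyE; simp add: input_state_def)
  qed (simp add: input_state_def)
qed

lemma decoder_result:
  fixes n a1 a2 i g r z m u b :: nat
  defines "s \<equiv> input_state [n, a1, a2, i, g, r, z, m, u, b]"
  shows "emitted decoder s = [tour_vertex n a2 g r z m u b i]"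
    "result decoder s = s(39 := tour_vertex n a2 g r z m u b i)"
proof -
  have "result (assign 39 vertex_exp) s = s(39 := val vertex_exp s)"
    by (rule result_assign[OF vars_vertex_exp]) (simp_all add: s_def input_state_def)
  moreover have "val vertex_exp s = tour_vertex n a2 g r z m u b i"
    by (simp add: val_vertex_exp s_def input_state_10)
  ultimately show "emitted decoder s = [tour_vertex n a2 g r z m u b i]"
    "result decoder s = s(39 := tour_vertex n a2 g r z m u b i)"
    by (simp_all add: decoder_def emitted_assign)
qed

lemma loop_free_decoder: "loop_free decoder"
  by (simp add: decoder_def loop_free_assign)

text \<open>Resetting register 39 turns the state back into an \<open>input_state\<close>. The width
  of a single step is therefore a bound for all rounds, instead of being multiplied in each.\<close>

definition tour_step :: prog where
  "tour_step = Seq decoder (Seq (Const 39 0) (assign 3 (Bin Plus (Var 3) (Num 1))))"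

definition tour_prog :: prog where
  "tour_prog = While (Less 3 0) tour_step"

lemma tour_step_result:
  "emitted tour_step (input_state [n, a1, a2, i, g, r, z, m, u, b]) = [tour_vertex n a2 g r z m u b i]"
  "result tour_step (input_state [n, a1, a2, i, g, r, z, m, u, b]) =
    input_state [n, a1, a2, Suc i, g, r, z, m, u, b]"
proof -
  let ?s = "input_state [n, a1, a2, i, g, r, z, m, u, b]"
  have c: "result (Const 39 0) (result decoder ?s) = ?s"
    by (simp add: decoder_result fun_eq_iff) (simp add: input_state_def)
  have a: "result (assign 3 (Bin Plus (Var 3) (Num 1))) ?s =
      ?s(3 := val (Bin Plus (Var 3) (Num 1)) ?s)"
    by (rule result_assign) (simp_all add: input_state_def)
  show "emitted tour_step ?s = [tour_vertex n a2 g r z m u b i]"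
    by (simp add: tour_step_def decoder_result emitted_assign)
  have "result tour_step ?s = ?s(3 := Suc i)"
    using a c by (simp add: tour_step_def input_state_10)
  also have "\<dots> = input_state [n, a1, a2, Suc i, g, r, z, m, u, b]"
    by (simp add: input_state_10 fun_eq_iff)
  finally show "result tour_step ?s = input_state [n, a1, a2, Suc i, g, r, z, m, u, b]" .
qed

lemma loop_free_tour_step: "loop_free tour_step"
  by (simp add: tour_step_def loop_free_decoder loop_free_assign)

text \<open>The position never exceeds \<open>n\<close>, whose length is already accounted for in
  register 0.\<close>

lemma input_state_numlen_update:
  assumes "\<And>j. numlen (input_state [n, a1, a2, 0, g, r, z, m, u, b] j) \<le> w" "i \<le> n"
  shows "numlen (input_state [n, a1, a2, i, g, r, z, m, u, b] j) \<le> w"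
  using assms(1)[of j] assms(1)[of 0] numlen_mono[OF assms(2)]
  by (auto simp: input_state_10 split: if_splits)

lemma exec_tour_prog:
  assumes w: "\<And>j. numlen (input_state [n, a1, a2, 0, g, r, z, m, u, b] j) \<le> w" and i: "i \<le> n"
  shows "\<exists>t b' s. exec (2 ^ weight tour_step * w) tour_prog
      (input_state [n, a1, a2, i, g, r, z, m, u, b])
      (map (tour_vertex n a2 g r z m u b) [i..<n]) t b' s \<and>
    t \<le> Suc (weight tour_step) * (n - i) + 1"
  using i
proof (induction "n - i" arbitrary: i)
  case 0
  then show ?case
    unfolding tour_prog_def using exec_While_false[of "Less 3 0" "input_state [n, a1, a2, i, g, r, z, m, u, b]"]
    by (force simp: input_state_def)
next
  case (Suc k)
  let ?s = "\<lambda>i. input_state [n, a1, a2, i, g, r, z, m, u, b]"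
  have "i < n" using Suc(2) by simp
  have "k = n - Suc i" "Suc i \<le> n" using Suc(2) by simp_all
  from Suc(1)[OF this] obtain t2 b2 s2 where 2: "exec (2 ^ weight tour_step * w) tour_prog (?s (Suc i))
      (map (tour_vertex n a2 g r z m u b) [Suc i..<n]) t2 b2 s2"
    "t2 \<le> Suc (weight tour_step) * (n - Suc i) + 1"
    by blast
  obtain t1 where 1: "exec (2 ^ weight tour_step * w) tour_step (?s i)
      [tour_vertex n a2 g r z m u b i] t1 (bits tour_step (?s i)) (?s (Suc i))" "t1 \<le> weight tour_step"
    using loop_free_exec[of tour_step "?s i" w, OF loop_free_tour_step input_state_numlen_update[OF w Suc(3)]]
    unfolding tour_step_result by blast
  have "holds (Less 3 0) (?s i)" using \<open>i < n\<close> by (simp add: input_state_def)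
  from exec_While_true[OF this 1(1) 2(1)[unfolded tour_prog_def]]
  have "exec (2 ^ weight tour_step * w) tour_prog (?s i)
      (map (tour_vertex n a2 g r z m u b) [i..<n]) (Suc (t1 + t2))
      (test_bits (Less 3 0) (?s i) + bits tour_step (?s i) + b2) s2"
    using \<open>i < n\<close> by (simp add: tour_prog_def upt_conv_Cons)
  moreover have "n - i = Suc (n - Suc i)" using \<open>i < n\<close> by simp
  then have "Suc (t1 + t2) \<le> Suc (weight tour_step) * (n - i) + 1"
    using 1(2) 2(2) by simp
  ultimately show ?case by blast
qed

definition candidate_exp :: "exp \<Rightarrow> exp" where
  "candidate_exp x = IfLess (Bin Modulo (Bin Plus x (Var 4)) (Num 2)) (Num 1) x (Bin Times (Num 2) (Var 0))"

text \<open>Registers 20 to 26 receive the Bezout coefficient \<open>w\<close>, the shift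
  \<open>t\<close>, the two candidates, their minimum \<open>A\<close>, the value
  \<open>max g A\<close> and the final cost. The last clearing leaves the parameters in the layout
  of the decoder, with position 0.\<close>

definition plan_prog :: prog where
  "plan_prog =
    Seq (assign 4 (Var 10))
    (Seq (assign 5 (Bin Divide (Var 0) (Var 4)))
    (Seq (assign 20 (IfLess (Var 14) (Num 1) (Bin Times (Var 12) (Bin Minus (Var 0) (Num 1))) (Var 12)))
    (Seq (assign 21 (Bin Modulo (Bin Times (Var 2) (Var 20)) (Var 5)))
    (Seq (assign 22 (candidate_exp (Var 21)))
    (Seq (assign 23 (candidate_exp (Bin Minus (Var 5) (Var 21))))
    (Seq (assign 24 (IfLess (Var 23) (Var 22) (Var 23) (Var 22)))
    (Seq (assign 9 (IfLess (Var 23) (Var 22) (Bin Minus (Var 0) (Var 1)) (Var 1)))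
    (Seq (assign 25 (IfLess (Var 4) (Var 24) (Var 24) (Var 4)))
    (Seq (assign 6 (IfLess (Var 25) (Bin Times (Num 2) (Bin Minus (Var 4) (Num 1))) (Num 1) (Num 0)))
    (Seq (assign 7 (Bin Divide (Bin Minus (Var 25) (Var 4)) (Num 2)))
    (Seq (assign 8 (Bin Divide (Bin Minus (Bin Plus (Var 24) (Var 4)) (Bin Times (Num 2) (Var 7))) (Num 2)))
    (Seq (assign 26 (IfLess (Num 0) (Var 6) (Bin Plus (Var 4) (Bin Times (Num 2) (Var 7)))
       (Bin Times (Num 2) (Bin Minus (Var 4) (Num 1)))))
    (Seq (Emit 26) (clear [10..<40]))))))))))))))"

lemma loop_free_plan_prog: "loop_free plan_prog"
  by (simp add: plan_prog_def loop_free_assign loop_free_clear)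

lemma result_assign':
  assumes "vars_below 40 e" "d < 40" "\<And>i. 40 \<le> i \<Longrightarrow> s i = 0" "val e s = v"
  shows "result (assign d e) s = s(d := v)"
  using result_assign[of e d s] assms by simp

lemma plan_prog_result:
  fixes s :: state
  assumes s: "s 0 = n" "s 1 = a1" "s 2 = a2" "\<And>i. i \<in> {3..<10} \<or> 18 \<le> i \<Longrightarrow> s i = 0"
    and g: "s 10 = g" and r: "n div g = r"
    and w: "(if s 14 < 1 then s 12 * (n - 1) else s 12) = w"
    and t: "(a2 * w) mod r = t"
    and A: "shift n g r t = A" and b: "row_step n a1 g r t = b"
    and z: "is_zigzag g (odd_cost g A) = z"
    and m: "(odd_cost g A - g) div 2 = m" and u: "(A + g - 2 * m) div 2 = u"
  shows "emitted plan_prog s = [if 0 < z then g + 2 * m else 2 * (g - 1)]"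
    "result plan_prog s = input_state [n, a1, a2, 0, g, r, z, m, u, b]"
proof -
  define c where "c = (if 0 < z then g + 2 * m else 2 * (g - 1))"
  define A1 A2 M where "A1 = shift_candidate n g t" "A2 = shift_candidate n g (r - t)" "M = odd_cost g A"
  note defs = A1_A2_M_def
  have s40: "s i = 0" if "40 \<le> i" for i using s(4) that by simp
  have 1: "result (assign 4 (Var 10)) s = s(4 := g)"
    by (rule result_assign') (simp_all add: s40 g)
  \<comment> \<open>Every intermediate state gets a name, so that each lookup unfolds only as far
    back as it needs.\<close>
  define s1 where "s1 = s(4 := g)"
  have z1: "\<And>i. 40 \<le> i \<Longrightarrow> s1 i = 0" by (simp add: s1_def s40)
  have 2: "result (assign 5 (Bin Divide (Var 0) (Var 4))) s1 = s1(5 := r)"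
    by (rule result_assign') (simp_all add: z1 s r, simp add: s1_def s r)
  define s2 where "s2 = s1(5 := r)"
  have z2: "\<And>i. 40 \<le> i \<Longrightarrow> s2 i = 0" by (simp add: s2_def z1)
  have 3: "result (assign 20 (IfLess (Var 14) (Num 1) (Bin Times (Var 12) (Bin Minus (Var 0) (Num 1))) (Var 12))) s2
      = s2(20 := w)"
    by (rule result_assign') (simp_all add: z2, simp add: s2_def s1_def s w[symmetric])
  define s3 where "s3 = s2(20 := w)"
  have z3: "\<And>i. 40 \<le> i \<Longrightarrow> s3 i = 0" by (simp add: s3_def z2)
  have 4: "result (assign 21 (Bin Modulo (Bin Times (Var 2) (Var 20)) (Var 5))) s3 = s3(21 := t)"
    by (rule result_assign') (simp_all add: z3, simp add: s3_def s2_def s1_def s t)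
  define s4 where "s4 = s3(21 := t)"
  have z4: "\<And>i. 40 \<le> i \<Longrightarrow> s4 i = 0" by (simp add: s4_def z3)
  have 5: "result (assign 22 (candidate_exp (Var 21))) s4 = s4(22 := A1)"
    by (rule result_assign') (simp_all add: z4 candidate_exp_def defs shift_candidate_def,
        simp add: s4_def s3_def s2_def s1_def s)
  define s5 where "s5 = s4(22 := A1)"
  have z5: "\<And>i. 40 \<le> i \<Longrightarrow> s5 i = 0" by (simp add: s5_def z4)
  have 6: "result (assign 23 (candidate_exp (Bin Minus (Var 5) (Var 21)))) s5 = s5(23 := A2)"
    by (rule result_assign') (simp_all add: z5 candidate_exp_def defs shift_candidate_def,
        simp add: s5_def s4_def s3_def s2_def s1_def s)
  define s6 where "s6 = s5(23 := A2)"
  have z6: "\<And>i. 40 \<le> i \<Longrightarrow> s6 i = 0" by (simp add: s6_def z5)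
  have 7: "result (assign 24 (IfLess (Var 23) (Var 22) (Var 23) (Var 22))) s6 = s6(24 := A)"
    by (rule result_assign') (simp_all add: z6, simp add: s6_def s5_def defs A[symmetric] shift_def)
  define s7 where "s7 = s6(24 := A)"
  have z7: "\<And>i. 40 \<le> i \<Longrightarrow> s7 i = 0" by (simp add: s7_def z6)
  have 8: "result (assign 9 (IfLess (Var 23) (Var 22) (Bin Minus (Var 0) (Var 1)) (Var 1))) s7 = s7(9 := b)"
    by (rule result_assign') (simp_all add: z7,
      simp add: s7_def s6_def s5_def s4_def s3_def s2_def s1_def s[unfolded One_nat_def] defs b[symmetric] row_step_def)
  define s8 where "s8 = s7(9 := b)"
  have z8: "\<And>i. 40 \<le> i \<Longrightarrow> s8 i = 0" by (simp add: s8_def z7)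
  have g4: "s7 4 = g" by (simp add: s7_def s6_def s5_def s4_def s3_def s2_def s1_def)
  have 9: "result (assign 25 (IfLess (Var 4) (Var 24) (Var 24) (Var 4))) s8 = s8(25 := M)"
    by (rule result_assign') (simp_all add: z8, simp add: s8_def g4, simp add: s7_def defs odd_cost_def)
  define s9 where "s9 = s8(25 := M)"
  have z9: "\<And>i. 40 \<le> i \<Longrightarrow> s9 i = 0" by (simp add: s9_def z8)
  have 10: "result (assign 6 (IfLess (Var 25) (Bin Times (Num 2) (Bin Minus (Var 4) (Num 1))) (Num 1) (Num 0))) s9
      = s9(6 := z)"
    by (rule result_assign') (simp_all add: z9, simp add: s9_def s8_def g4 defs z[symmetric] is_zigzag_def)
  define s10 where "s10 = s9(6 := z)"
  have z10: "\<And>i. 40 \<le> i \<Longrightarrow> s10 i = 0" by (simp add: s10_def z9)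
  have 11: "result (assign 7 (Bin Divide (Bin Minus (Var 25) (Var 4)) (Num 2))) s10 = s10(7 := m)"
    using m by (intro result_assign') (simp_all add: z10, simp add: s10_def s9_def s8_def g4 defs)
  define s11 where "s11 = s10(7 := m)"
  have z11: "\<And>i. 40 \<le> i \<Longrightarrow> s11 i = 0" by (simp add: s11_def z10)
  have s11': "s11 24 = A" "s11 4 = g" "s11 7 = m" "s11 6 = z"
    by (simp_all add: s11_def s10_def s9_def s8_def g4, simp add: s7_def)
  have 12: "result (assign 8 (Bin Divide (Bin Minus (Bin Plus (Var 24) (Var 4)) (Bin Times (Num 2) (Var 7))) (Num 2))) s11
      = s11(8 := u)"
    using u by (intro result_assign') (simp_all add: z11 s11')
  define s12 where "s12 = s11(8 := u)"
  have z12: "\<And>i. 40 \<le> i \<Longrightarrow> s12 i = 0" by (simp add: s12_def z11)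
  have 13: "result (assign 26 (IfLess (Num 0) (Var 6) (Bin Plus (Var 4) (Bin Times (Num 2) (Var 7)))
       (Bin Times (Num 2) (Bin Minus (Var 4) (Num 1))))) s12 = s12(26 := c)"
    by (rule result_assign') (simp_all add: z12, simp add: s12_def s11' c_def)
  note steps = 1[folded s1_def] 2[folded s2_def] 3[folded s3_def] 4[folded s4_def] 5[folded s5_def]
    6[folded s6_def] 7[folded s7_def] 8[folded s8_def] 9[folded s9_def] 10[folded s10_def]
    11[folded s11_def] 12[folded s12_def] 13
  show "emitted plan_prog s = [if 0 < z then g + 2 * m else 2 * (g - 1)]"
    unfolding plan_prog_def emitted.simps result.simps steps emitted_assign emitted_clear
    by (simp add: c_def)
  show "result plan_prog s = input_state [n, a1, a2, 0, g, r, z, m, u, b]"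
  proof
    fix i
    have "result plan_prog s i = (if i \<in> {10..<40} then 0 else s12 i)"
      unfolding plan_prog_def result.simps steps result_clear set_upt by simp
    also have "\<dots> = input_state [n, a1, a2, 0, g, r, z, m, u, b] i"
    proof (cases "i < 10")
      case True
      then have "i \<in> {0, 1, 2, 3, 4, 5, 6, 7, 8, 9}" by auto
      then show ?thesis
        by (elim insertE emptyE; simp add: input_state_def s12_def s11_def s10_def s9_def s8_def s7_def
            s6_def s5_def s4_def s3_def s2_def s1_def s s[unfolded One_nat_def])
    next
      case False
      then show ?thesis
        using z12[of i] by (auto simp: input_state_def)
    qed
    finally show "result plan_prog s i = input_state [n, a1, a2, 0, g, r, z, m, u, b] i" .
  qed
qed

definition param_prog :: prog where
  "param_prog = Seq (Emit 4) (Seq (Emit 5) (Seq (Emit 6) (Seq (Emit 7) (Seq (Emit 8) (Emit 9)))))"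

lemma param_prog_result:
  "emitted param_prog (input_state [n, a1, a2, 0, g, r, z, m, u, b]) = [g, r, z, m, u, b]"
  "result param_prog s = s"
  by (simp_all add: param_prog_def input_state_def)

lemma loop_free_param_prog: "loop_free param_prog"
  by (simp add: param_prog_def)

section \<open>Total time and bit complexity\<close>

definition cost_prog :: prog where
  "cost_prog = Seq euclid_init (Seq (While (Less 18 11) euclid_body) plan_prog)"

lemma numlen_le_Suc: "numlen n \<le> Suc n"
  by (simp add: numlen_le_Suc_iff)

lemma numlen_le_log:
  assumes "4 \<le> n"
  shows "real (numlen n) \<le> 2 * log 2 (real n)"
proof -
  have l: "2 \<le> log 2 (real n)"
    using assms by (subst le_log_iff) simp_all
  \<comment> \<open>One unit for the leading digit and one for the end mark; \<open>n >= 4\<close>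
    lets the logarithm absorb both.\<close>
  have "real (numlen n) = 2 + real (nat \<lfloor>log 2 (real n)\<rfloor>)"
    using assms by (simp add: numlen_def floorlog_def)
  also have "\<dots> \<le> 2 + log 2 (real n)" using l by simp
  finally show ?thesis using l by simp
qed

lemma loop_free_euclid_init: "loop_free euclid_init"
  by (simp add: euclid_init_def)

lemma emitted_euclid_init: "emitted euclid_init s = []"
  by (simp add: euclid_init_def)

lemma numlen_input_state_3:
  assumes "a1 \<le> n" "a2 \<le> n"
  shows "numlen (input_state [n, a1, a2] i) \<le> numlen n"
proof (intro numlen_mono)
  show "input_state [n, a1, a2] i \<le> n"
    using assms by (auto simp: input_state_def less_Suc_eq numeral_2_eq_2)
qed

lemma exec_loop_free:
  assumes "loop_free p" "\<And>i. numlen (s i) \<le> w" "2 ^ weight p * w \<le> W"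
  shows "\<exists>t b. exec W p s (emitted p s) t b (result p s) \<and> t \<le> weight p \<and>
    b \<le> weight p * (3 * (2 ^ weight p * w)\<^sup>2) \<and> (\<forall>i. numlen (result p s i) \<le> 2 ^ weight p * w)"
proof -
  obtain t where t: "exec (2 ^ weight p * w) p s (emitted p s) t (bits p s) (result p s)"
    "t \<le> weight p" "\<And>i. numlen (result p s i) \<le> 2 ^ weight p * w"
    using loop_free_exec[of p s w, OF assms(1,2)] by blast
  have "w \<le> 2 ^ weight p * w" by simp
  then have "numlen (s i) \<le> 2 ^ weight p * w" for i using assms(2) le_trans by blast
  then have "bits p s \<le> t * (3 * (2 ^ weight p * w)\<^sup>2)" using exec_bits_le[OF t(1)] by blast
  also have "\<dots> \<le> weight p * (3 * (2 ^ weight p * w)\<^sup>2)" using t(2) by (rule mult_le_mono1)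
  finally show ?thesis using exec_mono_width[OF t(1) assms(3)] t(2,3) by blast
qed

text \<open>The loop-free parts before and after the Euclidean loop cost a constant times
  \<open>(numlen n)\<^sup>2\<close>; the loop costs \<open>16 * N\<close> per unit of a potential
  that starts below \<open>4 * N\<close>, which gives the 64.\<close>

lemma exec_cost_prog:
  assumes inst: "two_stripe_instance n a1 a2"
  defines "W \<equiv> (2 ^ weight euclid_init + 2 ^ weight euclid_body + 2 ^ weight plan_prog) * numlen n"
  shows "\<exists>g r z m u b c t bt.
    optimal_tour n a1 a2 (map (tour_vertex n a2 g r z m u b) [0..<n]) \<and>
    tour_cost n a1 a2 (map (tour_vertex n a2 g r z m u b) [0..<n]) = enat c \<and>
    exec W cost_prog (input_state [n, a1, a2]) [c] t bt (input_state [n, a1, a2, 0, g, r, z, m, u, b]) \<and>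
    (\<forall>i. numlen (input_state [n, a1, a2, 0, g, r, z, m, u, b] i) \<le> 2 ^ weight plan_prog * numlen n) \<and>
    t \<le> weight euclid_init + Suc (weight euclid_body) * Suc (3 * numlen n) + weight plan_prog \<and>
    bt \<le> (weight euclid_init * (3 * (2 ^ weight euclid_init)\<^sup>2) + 64 +
      weight plan_prog * (3 * (2 ^ weight plan_prog)\<^sup>2)) * (numlen n)\<^sup>2"
proof -
  define N where "N = numlen n"
  have N1: "1 \<le> N" unfolding N_def by (rule numlen_ge_1)
  define g r where "g = gcd n a1" "r = n div gcd n a1"
  interpret stripes n a1 a2 g r
    by unfold_locales (use inst in \<open>simp_all add: g_r_def\<close>)
  have a: "1 \<le> a1" "a1 \<le> n" "a2 \<le> n" and n0: "0 < n"
    using a1_bounds a2_bounds n4 by simp_all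
  define s0 where "s0 = input_state [n, a1, a2]"
  define s1 where "s1 = result euclid_init s0"
  have W: "2 ^ weight euclid_init * N \<le> W" "2 ^ weight euclid_body * N \<le> W" "2 ^ weight plan_prog * N \<le> W"
    unfolding W_def N_def by (intro mult_le_mono1, simp)+
  have s0: "numlen (s0 i) \<le> N" for i
    unfolding s0_def N_def using a(2,3) by (rule numlen_input_state_3)
  obtain t1 b1 where e1: "exec W euclid_init s0 [] t1 b1 s1" "t1 \<le> weight euclid_init"
    "b1 \<le> weight euclid_init * (3 * (2 ^ weight euclid_init * N)\<^sup>2)"
    using exec_loop_free[of euclid_init s0 N, OF loop_free_euclid_init s0 W(1)]
    unfolding emitted_euclid_init s1_def[symmetric] by blast
  have inv1: "euclid_inv n a1 a2 s1" unfolding s1_def s0_def using a by (rule euclid_init)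
  obtain t2 b2 s2 where e2: "exec W (While (Less 18 11) euclid_body) s1 [] t2 b2 s2"
    "euclid_inv n a1 a2 s2" "s2 11 = 0"
    "t2 \<le> Suc (weight euclid_body) * Suc (2 * numlen (s1 10) + numlen (s1 11))"
    "b2 \<le> 16 * N * Suc (2 * numlen (s1 10) + numlen (s1 11))"
    using euclid_loop[OF inv1] exec_mono_width[OF _ W(2)] unfolding N_def by blast
  have "numlen (s1 10) \<le> N" "numlen (s1 11) \<le> N"
    using inv1 unfolding N_def euclid_inv_def by (auto intro: numlen_mono)
  then have \<Phi>: "Suc (2 * numlen (s1 10) + numlen (s1 11)) \<le> Suc (3 * N)" by simp
  then have t2: "t2 \<le> Suc (weight euclid_body) * Suc (3 * N)"
    using e2(4) mult_le_mono2 le_trans by blast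
  have "b2 \<le> 16 * N * Suc (3 * N)" using e2(5) \<Phi> mult_le_mono2 le_trans by blast
  also have "\<dots> \<le> 16 * N * (4 * N)" using N1 by (intro mult_le_mono2) simp
  finally have b2: "b2 \<le> 64 * N\<^sup>2" by (simp add: power2_eq_square)
  define w where "w = (if s2 14 < 1 then s2 12 * (n - 1) else s2 12)"
  define t where "t = (a2 * w) mod r"
  have w: "[w * a1 = g] (mod n)" and g10: "s2 10 = g"
    using euclid_bezout[OF e2(2,3) n0] by (simp_all add: w_def g_r_def)
  interpret stripes_shift n a1 a2 g r t
    unfolding t_def using w by (rule stripes_shift_bezout)
  define A where "A = shift n g r t"
  define b where "b = row_step n a1 g r t"
  define z where "z = is_zigzag g (odd_cost g A)"
  define m where "m = (odd_cost g A - g) div 2"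
  define u where "u = (A + g - 2 * m) div 2"
  define c where "c = (if 0 < z then g + 2 * m else 2 * (g - 1))"
  note opt = optimal_tour_vertex[folded A_def, folded z_def m_def, folded u_def b_def c_def]
  have s2: "s2 0 = n" "s2 1 = a1" "s2 2 = a2" "\<And>i. i \<in> {3..<10} \<or> 18 \<le> i \<Longrightarrow> s2 i = 0"
    "\<And>i. s2 i \<le> n"
    using e2(2) unfolding euclid_inv_def by blast+
  have plan: "emitted plan_prog s2 = [c]"
    "result plan_prog s2 = input_state [n, a1, a2, 0, g, r, z, m, u, b]"
    unfolding c_def
    by (rule plan_prog_result[of s2 n a1 a2 g r w t A b z m u, OF s2(1-4) g10 r_def[symmetric]
      w_def[symmetric] t_def[symmetric] A_def[symmetric] b_def[symmetric] z_def[symmetric]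
      m_def[symmetric] u_def[symmetric]]; assumption)+
  have "numlen (s2 i) \<le> N" for i unfolding N_def using s2(5) by (rule numlen_mono)
  then obtain t3 b3 where e3: "exec W plan_prog s2 [c] t3 b3 (input_state [n, a1, a2, 0, g, r, z, m, u, b])"
    "t3 \<le> weight plan_prog" "b3 \<le> weight plan_prog * (3 * (2 ^ weight plan_prog * N)\<^sup>2)"
    "\<forall>i. numlen (input_state [n, a1, a2, 0, g, r, z, m, u, b] i) \<le> 2 ^ weight plan_prog * N"
    using exec_loop_free[OF loop_free_plan_prog _ W(3), of s2] unfolding plan by blast
  have "exec W cost_prog s0 [c] (t1 + (t2 + t3)) (b1 + (b2 + b3))
      (input_state [n, a1, a2, 0, g, r, z, m, u, b])"
    unfolding cost_prog_def using exec_Seq[OF e1(1) exec_Seq[OF e2(1) e3(1)]] by simp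
  moreover have "t1 + (t2 + t3) \<le> weight euclid_init + Suc (weight euclid_body) * Suc (3 * N) + weight plan_prog"
    using e1(2) t2 e3(2) by linarith
  moreover have "b1 + (b2 + b3) \<le> (weight euclid_init * (3 * (2 ^ weight euclid_init)\<^sup>2) + 64 +
      weight plan_prog * (3 * (2 ^ weight plan_prog)\<^sup>2)) * N\<^sup>2"
  proof -
    have "b1 + (b2 + b3) \<le> weight euclid_init * (3 * (2 ^ weight euclid_init * N)\<^sup>2) + (64 * N\<^sup>2 +
      weight plan_prog * (3 * (2 ^ weight plan_prog * N)\<^sup>2))"
      using e1(3) b2 e3(3) by (intro add_mono)
    also have "\<dots> = (weight euclid_init * (3 * (2 ^ weight euclid_init)\<^sup>2) + 64 +
      weight plan_prog * (3 * (2 ^ weight plan_prog)\<^sup>2)) * N\<^sup>2"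
      by (simp only: power_mult_distrib add_mult_distrib mult.assoc add.assoc)
    finally show ?thesis .
  qed
  ultimately show ?thesis using opt e3(4) unfolding N_def s0_def by blast
qed

theorem theorem5:
  shows "\<exists>(cost_prog :: prog) (param_prog :: prog) (tour_prog :: prog) (decoder :: prog)
            (k :: nat) (C :: nat). loop_free decoder \<and>
    (\<forall>n a1 a2 :: nat. two_stripe_instance n a1 a2 \<longrightarrow>
      (\<exists>(xs :: nat list) (ps :: nat list) (c :: nat) t1 b1 s1 t2 b2 s2 t3 b3 s3.
        optimal_tour n a1 a2 xs \<and> tour_cost n a1 a2 xs = enat c \<and>
        exec (C * numlen n) cost_prog (input_state [n, a1, a2]) [c] t1 b1 s1 \<and>
        real b1 \<le> real C * (log 2 (real n))\<^sup>2 \<and>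
        exec (C * numlen n) param_prog s1 ps t2 b2 s2 \<and>
        real b2 \<le> real C * (log 2 (real n))\<^sup>2 \<and>
        length ps = k \<and> describes (C * numlen n) decoder n a1 a2 ps xs \<and>
        exec (C * numlen n) tour_prog s2 xs t3 b3 s3 \<and>
        t1 + t2 + t3 \<le> C * n))"
proof -
  \<comment> \<open>\<open>K\<close> is the growth of the lengths during planning, which
    \<open>param_prog\<close>, \<open>tour_prog\<close> and \<open>decoder\<close> inherit.
    \<open>D1\<close> and \<open>D2\<close> bound bit operations in terms of
    \<open>numlen n\<close>, \<open>V\<close> the width of \<open>cost_prog\<close>, and
    \<open>T\<close> the unit-cost time divided by \<open>n\<close>. The factors 4 in
    \<open>C\<close> come from squaring \<open>numlen n <= 2 * log 2 n\<close>.\<close>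
  define K where "K = (2 :: nat) ^ weight plan_prog"
  define D1 where "D1 = weight euclid_init * (3 * (2 ^ weight euclid_init)\<^sup>2) + 64 +
      weight plan_prog * (3 * (2 ^ weight plan_prog)\<^sup>2)"
  define D2 where "D2 = weight param_prog * (3 * (2 ^ weight param_prog * K)\<^sup>2)"
  define V where "V = (2 :: nat) ^ weight euclid_init + 2 ^ weight euclid_body + 2 ^ weight plan_prog"
  define T where "T = weight euclid_init + 7 * Suc (weight euclid_body) + weight plan_prog
      + weight param_prog + Suc (weight tour_step) + 1"
  define C where "C = 4 * D1 + 4 * D2 + V + 2 ^ weight param_prog * K + 2 ^ weight tour_step * K
      + 2 ^ weight decoder * K + T"
  have main: "\<exists>xs ps c t1 b1 s1 t2 b2 s2 t3 b3 s3.
        optimal_tour n a1 a2 xs \<and> tour_cost n a1 a2 xs = enat c \<and>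
        exec (C * numlen n) cost_prog (input_state [n, a1, a2]) [c] t1 b1 s1 \<and>
        real b1 \<le> real C * (log 2 (real n))\<^sup>2 \<and>
        exec (C * numlen n) param_prog s1 ps t2 b2 s2 \<and>
        real b2 \<le> real C * (log 2 (real n))\<^sup>2 \<and>
        length ps = 6 \<and> describes (C * numlen n) decoder n a1 a2 ps xs \<and>
        exec (C * numlen n) tour_prog s2 xs t3 b3 s3 \<and>
        t1 + t2 + t3 \<le> C * n"
    if inst: "two_stripe_instance n a1 a2" for n a1 a2
  proof -
    define N where "N = numlen n"
    interpret stripes n a1 a2 "gcd n a1" "n div gcd n a1"
      by unfold_locales (use inst in simp_all)
    have log_bound: "real b \<le> real C * (log 2 (real n))\<^sup>2" if "b \<le> D * N\<^sup>2" "4 * D \<le> C" for b D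
    proof -
      have "real b \<le> real D * (real N)\<^sup>2" using that(1)
        by (metis of_nat_le_iff of_nat_mult of_nat_power)
      also have "\<dots> \<le> real D * (2 * log 2 (real n))\<^sup>2"
        unfolding N_def using numlen_le_log[OF n4] by (intro mult_left_mono power_mono) auto
      also have "\<dots> = real (4 * D) * (log 2 (real n))\<^sup>2" by (simp add: power_mult_distrib)
      also have "\<dots> \<le> real C * (log 2 (real n))\<^sup>2"
        using that(2) by (intro mult_right_mono) (simp_all only: of_nat_le_iff zero_le_power2)
      finally show ?thesis .
    qed
    have width: "D * N \<le> C * N" if "D \<le> C" for D using that by (rule mult_le_mono1)
    obtain g r z m u b c t1 b1 where
      opt: "optimal_tour n a1 a2 (map (tour_vertex n a2 g r z m u b) [0..<n])"
        "tour_cost n a1 a2 (map (tour_vertex n a2 g r z m u b) [0..<n]) = enat c"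
      and cost: "exec (V * N) cost_prog (input_state [n, a1, a2]) [c] t1 b1
        (input_state [n, a1, a2, 0, g, r, z, m, u, b])"
      and len: "\<And>i. numlen (input_state [n, a1, a2, 0, g, r, z, m, u, b] i) \<le> K * N"
      and t1: "t1 \<le> weight euclid_init + Suc (weight euclid_body) * Suc (3 * N) + weight plan_prog"
      and b1: "b1 \<le> D1 * N\<^sup>2"
      using exec_cost_prog[OF inst] unfolding V_def K_def D1_def N_def by blast
    define xs where "xs = map (tour_vertex n a2 g r z m u b) [0..<n]"
    let ?s = "\<lambda>i. input_state [n, a1, a2, i, g, r, z, m, u, b]"
    have cost': "exec (C * N) cost_prog (input_state [n, a1, a2]) [c] t1 b1 (?s 0)"
      using cost by (rule exec_mono_width) (rule width, simp add: C_def)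
    have "2 ^ weight param_prog * (K * N) \<le> C * N"
      unfolding mult.assoc[symmetric] by (rule width) (simp add: C_def)
    from exec_loop_free[of param_prog "?s 0" "K * N", OF loop_free_param_prog len this]
    obtain t2 b2 where param: "exec (C * N) param_prog (?s 0) [g, r, z, m, u, b] t2 b2 (?s 0)"
      "t2 \<le> weight param_prog" "b2 \<le> weight param_prog * (3 * (2 ^ weight param_prog * (K * N))\<^sup>2)"
      unfolding param_prog_result by blast
    have b2: "b2 \<le> D2 * N\<^sup>2"
      using param(3) by (simp only: D2_def power_mult_distrib mult.assoc)
    have wt: "2 ^ weight tour_step * (K * N) \<le> C * N"
      unfolding mult.assoc[symmetric] by (rule width) (simp add: C_def)
    obtain t3 b3 s3 where e3: "exec (2 ^ weight tour_step * (K * N)) tour_prog (?s 0) xs t3 b3 s3"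
      and t3: "t3 \<le> Suc (weight tour_step) * (n - 0) + 1"
      using exec_tour_prog[OF len le0] unfolding xs_def by blast
    from e3 wt have tour: "exec (C * N) tour_prog (?s 0) xs t3 b3 s3" by (rule exec_mono_width)
    have wd: "2 ^ weight decoder * (K * N) \<le> C * N"
      unfolding mult.assoc[symmetric] by (rule width) (simp add: C_def)
    have desc: "describes (C * N) decoder n a1 a2 [g, r, z, m, u, b] xs"
      unfolding describes_def
    proof (intro allI impI)
      fix i assume "i < length xs"
      then have i: "i < n" by (simp add: xs_def)
      then have x: "xs ! i = tour_vertex n a2 g r z m u b i" by (simp add: xs_def)
      have "numlen (?s i j) \<le> K * N" for j
        by (rule input_state_numlen_update[OF len]) (use i in simp)
      from exec_loop_free[of decoder "?s i" "K * N", OF loop_free_decoder this wd]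
      show "\<exists>t b' s. exec (C * N) decoder (input_state ([n, a1, a2, i] @ [g, r, z, m, u, b])) [xs ! i] t b' s"
        unfolding x decoder_result append_Cons append_Nil by blast
    qed
    \<comment> \<open>With \<open>N <= n + 1\<close> the left side is at most
      \<open>3 * n + 4\<close>. Linear time is ample for the O(log n) rounds of the Euclidean
      loop.\<close>
    have "Suc (3 * N) \<le> 7 * n" using numlen_le_Suc[of n] n4 by (simp add: N_def)
    then have "Suc (weight euclid_body) * Suc (3 * N) \<le> Suc (weight euclid_body) * (7 * n)"
      by (rule mult_le_mono2)
    moreover have "weight euclid_init \<le> weight euclid_init * n" "weight plan_prog \<le> weight plan_prog * n"
      "weight param_prog \<le> weight param_prog * n" "1 \<le> n" using n4 by simp_all
    moreover have "T * n = weight euclid_init * n + Suc (weight euclid_body) * (7 * n) + weight plan_prog * n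
      + weight param_prog * n + Suc (weight tour_step) * n + n"
      by (simp add: T_def add_mult_distrib)
    ultimately have "t1 + t2 + t3 \<le> T * n" using t1 param(2) t3[unfolded diff_zero] by linarith
    also have "T * n \<le> C * n" by (rule mult_le_mono1) (simp add: C_def)
    finally have time: "t1 + t2 + t3 \<le> C * n" .
    have "4 * D1 \<le> C" "4 * D2 \<le> C" by (simp_all add: C_def)
    then have "real b1 \<le> real C * (log 2 (real n))\<^sup>2" "real b2 \<le> real C * (log 2 (real n))\<^sup>2"
      using log_bound b1 b2 by blast+
    with opt[folded xs_def] cost' param(1) desc tour time show ?thesis
      unfolding N_def
      by - (rule exI[of _ xs], rule exI[of _ "[g, r, z, m, u, b]"], rule exI[of _ c],
        rule exI[of _ t1], rule exI[of _ b1], rule exI[of _ "?s 0"], rule exI[of _ t2],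
        rule exI[of _ b2], rule exI[of _ "?s 0"], rule exI[of _ t3], rule exI[of _ b3],
        rule exI[of _ s3], simp)
  qed
  show ?thesis
    by (rule exI[of _ cost_prog], rule exI[of _ param_prog], rule exI[of _ tour_prog],
      rule exI[of _ decoder], rule exI[of _ 6], rule exI[of _ C])
      (use main loop_free_decoder in blast)
qed

end
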